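(* \textsc{Strong Triadic Closure} can be solved in $\ell^{\mathcal{O}(\ell)}\cdot n$ time, where $n$ is the number of vertices of the input graph and $\ell:=|E|-k$.
   Context: All graphs are finite, undirected and simple. A labeling of $G=(V,E)$ is a partition $(S_L,W_L)$ of $E$ into strong and weak edges; it is an STC-labeling if there are no strong edges $\{u,v\},\{v,w\}\in S_L$ with $\{u,w\}\notin E$. \textsc{Strong Triadic Closure}: given $G=(V,E)$ and $k\in\mathbb{N}$, decide whether $G$ has an STC-labeling with $|W_L|\le k$, i.e., with at least $\ell=|E|-k$ strong edges. *)

theory Defs
  imports Complex_Main "HOL-Library.Landau_Symbols"
begin

section \<open>Strong triadic closure\<close>

definition ugraph :: "'a set \<Rightarrow> 'a set set \<Rightarrow> bool" where
  "ugraph V E \<longleftrightarrow> finite V \<and> (\<forall>e\<in>E. e \<subseteq> V \<and> card e = 2)"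

text \<open>As usual for partitions into named classes, \<open>S\<close> or \<open>W\<close> may be empty.\<close>

definition labeling :: "'a set set \<Rightarrow> 'a set set \<Rightarrow> 'a set set \<Rightarrow> bool" where
  "labeling E S W \<longleftrightarrow> S \<union> W = E \<and> S \<inter> W = {}"

text \<open>The condition concerns two distinct strong edges at \<open>v\<close>; without \<open>u \<noteq> w\<close> every
  strong edge would violate it, since \<open>{u,u}\<close> is never an edge.\<close>

definition stc_labeling :: "'a set set \<Rightarrow> 'a set set \<Rightarrow> 'a set set \<Rightarrow> bool" where
  "stc_labeling E S W \<longleftrightarrow> labeling E S W \<and>
     \<not> (\<exists>u v w. u \<noteq> w \<and> {u, v} \<in> S \<and> {v, w} \<in> S \<and> {u, w} \<notin> E)"

definition strong_triadic_closure :: "'a set set \<Rightarrow> nat \<Rightarrow> bool" where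
  "strong_triadic_closure E k \<longleftrightarrow> (\<exists>S W. stc_labeling E S W \<and> card W \<le> k)"


section \<open>Word RAM programs\<close>

text \<open>Structured programs over finitely many named arrays of natural numbers; a scalar is
  cell \<open>0\<close> of an array. Every operator, memory access, assignment and test costs one time unit.
  The parameter \<open>B\<close> of the semantics is the largest number a machine word can hold: all
  constants, indices, intermediate and stored values must be at most \<open>B\<close>, and a computation
  that exceeds \<open>B\<close> is stuck. Unit cost is therefore only charged for operations on words.\<close>

datatype bop = Add | Sub | Mul | Div | Mod | Less | Eq

datatype exp = Const nat | Read string exp | Bin bop exp exp

datatype com =
    Skip
  | Assign string exp exp   \<comment> \<open>\<open>Assign x i e\<close> stores \<open>e\<close> in cell \<open>i\<close> of array \<open>x\<close>\<close>
  | Seq com com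
  | If exp com com
  | While exp com

type_synonym state = "string \<Rightarrow> nat \<Rightarrow> nat"

text \<open>Subtraction truncates at \<open>0\<close>.\<close>

fun bop_val :: "bop \<Rightarrow> nat \<Rightarrow> nat \<Rightarrow> nat" where
  "bop_val Add a b = a + b"
| "bop_val Sub a b = a - b"
| "bop_val Mul a b = a * b"
| "bop_val Div a b = a div b"
| "bop_val Mod a b = a mod b"
| "bop_val Less a b = (if a < b then 1 else 0)"
| "bop_val Eq a b = (if a = b then 1 else 0)"

fun val :: "state \<Rightarrow> exp \<Rightarrow> nat" where
  "val s (Const a) = a"
| "val s (Read x e) = s x (val s e)"
| "val s (Bin f e1 e2) = bop_val f (val s e1) (val s e2)"

fun fits :: "nat \<Rightarrow> state \<Rightarrow> exp \<Rightarrow> bool" where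
  "fits B s (Const a) \<longleftrightarrow> a \<le> B"
| "fits B s (Read x e) \<longleftrightarrow> fits B s e \<and> val s (Read x e) \<le> B"
| "fits B s (Bin f e1 e2) \<longleftrightarrow> fits B s e1 \<and> fits B s e2 \<and> val s (Bin f e1 e2) \<le> B"

fun cost :: "exp \<Rightarrow> nat" where
  "cost (Const a) = 1"
| "cost (Read x e) = 1 + cost e"
| "cost (Bin f e1 e2) = 1 + cost e1 + cost e2"

definition store :: "state \<Rightarrow> string \<Rightarrow> nat \<Rightarrow> nat \<Rightarrow> state" where
  "store s x i a = s(x := (s x)(i := a))"

text \<open>\<open>run B c s t s'\<close>: with words up to \<open>B\<close>, program \<open>c\<close> started in \<open>s\<close> halts in
  \<open>s'\<close> after exactly \<open>t\<close> time units.\<close>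

inductive run :: "nat \<Rightarrow> com \<Rightarrow> state \<Rightarrow> nat \<Rightarrow> state \<Rightarrow> bool" for B where
  Skip: "run B Skip s 1 s"
| Assign: "fits B s i \<Longrightarrow> fits B s e \<Longrightarrow>
    run B (Assign x i e) s (1 + cost i + cost e) (store s x (val s i) (val s e))"
| Seq: "run B c1 s t1 s1 \<Longrightarrow> run B c2 s1 t2 s2 \<Longrightarrow> run B (Seq c1 c2) s (t1 + t2) s2"
| IfTrue: "fits B s b \<Longrightarrow> val s b \<noteq> 0 \<Longrightarrow> run B c1 s t s' \<Longrightarrow>
    run B (If b c1 c2) s (1 + cost b + t) s'"
| IfFalse: "fits B s b \<Longrightarrow> val s b = 0 \<Longrightarrow> run B c2 s t s' \<Longrightarrow>
    run B (If b c1 c2) s (1 + cost b + t) s'"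
| WhileFalse: "fits B s b \<Longrightarrow> val s b = 0 \<Longrightarrow> run B (While b c) s (1 + cost b) s"
| WhileTrue: "fits B s b \<Longrightarrow> val s b \<noteq> 0 \<Longrightarrow> run B c s t1 s1 \<Longrightarrow>
    run B (While b c) s1 t2 s2 \<Longrightarrow> run B (While b c) s (1 + cost b + t1 + t2) s2"

inductive_cases run_SkipE: "run B Skip s t s'"
inductive_cases run_AssignE: "run B (Assign x i e) s t s'"
inductive_cases run_SeqE: "run B (Seq c1 c2) s t s'"
inductive_cases run_IfE: "run B (If b c1 c2) s t s'"
inductive_cases run_WhileE: "run B (While b c) s t s'"

lemma run_deterministic:
  "run B c s t s' \<Longrightarrow> run B c s u s'' \<Longrightarrow> u = t \<and> s'' = s'"
proof (induction arbitrary: u s'' rule: run.induct)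
  case (Skip s)
  then show ?case by (rule run_SkipE) simp
next
  case (Assign s i e x)
  from Assign.prems show ?case by (rule run_AssignE) simp
next
  case (Seq c1 s t1 s1 c2 t2 s2)
  from Seq.prems obtain a b r where r: "u = a + b" "run B c1 s a r" "run B c2 r b s''"
    by (rule run_SeqE)
  from Seq.IH(1)[OF r(2)] have "a = t1" "r = s1" by simp_all
  with r Seq.IH(2) show ?case by simp
next
  case (IfTrue s b c1 t s' c2)
  from IfTrue.prems IfTrue.hyps(2) obtain a where r: "u = 1 + cost b + a" "run B c1 s a s''"
    by (elim run_IfE) auto
  from r(1) IfTrue.IH[OF r(2)] show ?case by simp
next
  case (IfFalse s b c2 t s' c1)
  from IfFalse.prems IfFalse.hyps(2) obtain a where r: "u = 1 + cost b + a" "run B c2 s a s''"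
    by (elim run_IfE) auto
  from r(1) IfFalse.IH[OF r(2)] show ?case by simp
next
  case (WhileFalse s b c)
  from WhileFalse.prems show ?case
    by (rule run_WhileE) (use WhileFalse.hyps(2) in simp_all)
next
  case (WhileTrue s b c t1 s1 t2 s2)
  from WhileTrue.prems obtain a a' r
    where r: "u = 1 + cost b + a + a'" "run B c s a r" "run B (While b c) r a' s''"
    by (rule run_WhileE) (use WhileTrue.hyps(2) in simp_all)
  from WhileTrue.IH(1)[OF r(2)] have "a = t1" "r = s1" by simp_all
  with r WhileTrue.IH(2) show ?case by simp
qed


section \<open>Encoding of instances\<close>

text \<open>Every edge occurs exactly once, in an arbitrary order and orientation.\<close>

definition edge_list :: "'a set set \<Rightarrow> ('a \<times> 'a) list \<Rightarrow> bool" where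
  "edge_list E es \<longleftrightarrow>
     distinct (map (\<lambda>(u, v). {u, v}) es) \<and> set (map (\<lambda>(u, v). {u, v}) es) = E"

text \<open>The number of edges is part of the input: \<open>card E - k\<close> could not be computed within a
  time bound linear in the number of vertices if the edges had to be counted one by one.\<close>

definition stc_input :: "nat \<Rightarrow> (nat \<times> nat) list \<Rightarrow> nat \<Rightarrow> state" where
  "stc_input n es k = (\<lambda>x i.
     if x = ''n'' \<and> i = 0 then n
     else if x = ''m'' \<and> i = 0 then length es
     else if x = ''k'' \<and> i = 0 then k
     else if x = ''src'' \<and> i < length es then fst (es ! i)
     else if x = ''dst'' \<and> i < length es then snd (es ! i)
     else 0)"

definition solves_stc ::
  "com \<Rightarrow> nat \<Rightarrow> nat \<Rightarrow> nat set set \<Rightarrow> (nat \<times> nat) list \<Rightarrow> nat \<Rightarrow> nat \<Rightarrow> bool" where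
  "solves_stc P B n E es k t \<longleftrightarrow>
     (\<exists>s. run B P (stc_input n es k) t s \<and>
          s ''out'' 0 = (if strong_triadic_closure E k then 1 else 0))"

end

theory Submission
  imports Defs
begin

text \<open>Subsets of strong edge sets are strong, so one looks for exactly \<open>l\<close> strong edges. A matching is
  strong, so if a greedy maximal matching has \<open>l\<close> edges the answer is yes; otherwise its end points
  form a vertex cover of size less than \<open>2 * l\<close>, and only \<open>O(l * n)\<close> edges have been read. The strong
  neighbours of a vertex form a clique, hence contain at most one vertex outside the cover. So a
  solution is described by \<open>l\<close> pairs of labels, where a label denotes a cover vertex or one of at most
  \<open>l\<close> anonymous outside vertices. An outside vertex may be replaced by any unused vertex adjacent to
  all cover vertices within strong distance two of it; the least such vertex has rank less than
  \<open>3 * l\<close> among the candidates, so guessing a rank suffices. All in all \<open>3 * l\<close> digits below \<open>3 * l\<close>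
  are guessed by an odometer, which gives \<open>(3 * l) ^ (3 * l)\<close> rounds of time \<open>O(l ^ 3 * n)\<close>. The
  final check runs on actual vertices and is thus sound for every guess.\<close>

section \<open>Strong edge sets and guesses\<close>

text \<open>Anonymous labels work because vertices outside a cover are pairwise nonadjacent: two of
  them are never the ends of a path of two strong edges, so no closure condition relates them. Hence
  the vertices admissible for a label depend only on the cover part of the guess, and ranks can be
  appended as further digits without circularity. The bound \<open>3 * l\<close> on a rank counts
  what a least choice may have to avoid: fewer than \<open>2 * l\<close> cover vertices and at most
  \<open>l\<close> outside ones. Two features of the machine shape the program. Time linear in
  \<open>n\<close> forbids clearing an adjacency matrix of \<open>n * n\<close> cells; it is used
  uncleared, since cells that are not part of the input hold 0. Words are polynomially bounded, so
  the number of a guess, which may be close to \<open>(3 * l) ^ (3 * l)\<close>, does not fit into a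
  cell; only its digits are stored.\<close>

definition stc_set :: "'a set set \<Rightarrow> 'a set set \<Rightarrow> bool" where
  "stc_set E S \<longleftrightarrow> S \<subseteq> E \<and> (\<forall>u v w. u \<noteq> w \<longrightarrow> {u, v} \<in> S \<longrightarrow> {v, w} \<in> S \<longrightarrow> {u, w} \<in> E)"

lemma stc_set_subset: "stc_set E S \<Longrightarrow> T \<subseteq> S \<Longrightarrow> stc_set E T"
  unfolding stc_set_def by blast

lemma ugraph_finite: "ugraph V E \<Longrightarrow> finite E"
  by (metis Pow_iff finite_Pow_iff rev_finite_subset subsetI ugraph_def)

lemma ugraph_irrefl: "ugraph V E \<Longrightarrow> {u, v} \<in> E \<Longrightarrow> u \<noteq> v"
  unfolding ugraph_def by fastforce

lemma ugraph_edgeE: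
  assumes "ugraph V E" "e \<in> E" "u \<in> e"
  obtains v where "e = {u, v}" "v \<in> V" "u \<in> V" "u \<noteq> v"
proof -
  have "card e = 2" "e \<subseteq> V" using assms by (auto simp: ugraph_def)
  then obtain p q where "e = {p, q}" "p \<noteq> q" by (auto simp: card_2_iff)
  with assms(3) \<open>e \<subseteq> V\<close> that show thesis by fastforce
qed

text \<open>Only the strong class matters, the weak one being its complement in \<open>E\<close>.
  Truncated subtraction is harmless: for \<open>k\<close> above \<open>card E\<close> both sides
  hold, by the empty strong set.\<close>

lemma strong_triadic_closure_iff:
  assumes "finite E"
  shows "strong_triadic_closure E k \<longleftrightarrow> (\<exists>S. stc_set E S \<and> card S = card E - k)"
proof
  assume "strong_triadic_closure E k"
  then obtain S W where "stc_labeling E S W" "card W \<le> k"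
    unfolding strong_triadic_closure_def by blast
  then have SW: "S \<union> W = E" "S \<inter> W = {}" "card W \<le> k"
    and stc: "\<not> (\<exists>u v w. u \<noteq> w \<and> {u, v} \<in> S \<and> {v, w} \<in> S \<and> {u, w} \<notin> E)"
    unfolding stc_labeling_def labeling_def by simp_all
  have "S \<subseteq> E" using SW(1) by blast
  then have set: "stc_set E S"
    unfolding stc_set_def by (intro conjI allI impI) (use stc in blast)+
  have "card E = card S + card W"
    using SW(1,2) assms by (metis card_Un_disjoint finite_Un)
  with SW(3) have "card E - k \<le> card S" by simp
  then obtain T where "T \<subseteq> S" "card T = card E - k"
    by (meson obtain_subset_with_card_n)
  with set stc_set_subset show "\<exists>S. stc_set E S \<and> card S = card E - k" by blast
next
  assume "\<exists>S. stc_set E S \<and> card S = card E - k"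
  then obtain S where S: "stc_set E S" "card S = card E - k" by blast
  then have sub: "S \<subseteq> E" by (simp add: stc_set_def)
  have "card (E - S) \<le> k"
    using card_Diff_subset[OF finite_subset[OF sub assms] sub] S(2) by simp
  moreover have "labeling E S (E - S)" using sub unfolding labeling_def by blast
  moreover have "\<not> (\<exists>u v w. u \<noteq> w \<and> {u, v} \<in> S \<and> {v, w} \<in> S \<and> {u, w} \<notin> E)"
    using S(1) unfolding stc_set_def by meson
  ultimately have "card (E - S) \<le> k \<and> stc_labeling E S (E - S)"
    unfolding stc_labeling_def by simp
  then show "strong_triadic_closure E k"
    unfolding strong_triadic_closure_def by blast
qed

text \<open>A guess \<open>g\<close> assigns to the \<open>j\<close>-th strong edge the labels \<open>g j\<close> and \<open>g (l + j)\<close> of its end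
  points. A label \<open>i < 2 * l\<close> stands for the cover vertex \<open>x i\<close>; a label \<open>f\<close> with \<open>2 * l \<le> f < 3 * l\<close>
  stands for the candidate for \<open>f\<close> that has exactly \<open>g f\<close> smaller candidates. Being a candidate only
  involves cover vertices, so candidates for different labels can be chosen independently. The
  function \<open>y\<close> maps labels to vertices.\<close>

definition good :: "nat set set \<Rightarrow> nat \<Rightarrow> (nat \<Rightarrow> nat) \<Rightarrow> (nat \<Rightarrow> nat) \<Rightarrow> bool" where
  "good E l y g \<longleftrightarrow> (\<forall>j<l. \<forall>h<l. {y (g j), y (g (l + j))} \<in> E \<and> (j \<noteq> h \<longrightarrow>
     (y (g j) = y (g h) \<longrightarrow> {y (g (l + j)), y (g (l + h))} \<in> E) \<and>
     (y (g j) = y (g (l + h)) \<longrightarrow> {y (g (l + j)), y (g h)} \<in> E) \<and>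
     (y (g (l + j)) = y (g (l + h)) \<longrightarrow> {y (g j), y (g h)} \<in> E)))"

text \<open>Each clause is closure at a cover neighbour \<open>x (g j)\<close> of the vertex
  labelled \<open>f\<close>: the edge itself, then the edges to the other strong neighbours of
  \<open>x (g j)\<close>, which occur as second or as first ends of further pairs. Closure at
  \<open>v\<close> itself concerns two cover vertices and does not depend on the choice of
  \<open>v\<close>.\<close>

definition cand :: "nat set set \<Rightarrow> nat \<Rightarrow> (nat \<Rightarrow> nat) \<Rightarrow> (nat \<Rightarrow> nat) \<Rightarrow> nat \<Rightarrow> nat \<Rightarrow> bool" where
  "cand E l x g f v \<longleftrightarrow> (\<forall>j<l. \<forall>h<l. g (l + j) = f \<longrightarrow> {v, x (g j)} \<in> E \<and>
     (g h = g j \<and> g (l + h) < 2 * l \<longrightarrow> {v, x (g (l + h))} \<in> E) \<and>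
     (g (l + h) = g j \<longrightarrow> {v, x (g h)} \<in> E))"

text \<open>A label without a candidate of the guessed rank is left unconstrained, since the program
  then keeps whatever vertex \<open>y\<close> held before.\<close>

definition filled ::
  "nat set set \<Rightarrow> nat \<Rightarrow> nat \<Rightarrow> (nat \<Rightarrow> nat) \<Rightarrow> (nat \<Rightarrow> nat) \<Rightarrow> (nat \<Rightarrow> nat) \<Rightarrow> bool" where
  "filled E n l x g y \<longleftrightarrow> (\<forall>i<2 * l. y i = x i) \<and>
     (\<forall>f v. 2 * l \<le> f \<and> f < 3 * l \<and> v < n \<and> cand E l x g f v \<and>
        card {u. u < v \<and> cand E l x g f u} = g f \<longrightarrow> y f = v)"

section \<open>Soundness and completeness of guesses\<close>

text \<open>Demanding the closing edge for all positions \<open>j \<noteq> h\<close> also forces the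
  \<open>l\<close> edges to be distinct: if two of them were equal, the closing edge would be a
  loop.\<close>

lemma good_imp_stc_set:
  assumes G: "ugraph V E" and g: "good E l y g"
  shows "\<exists>S. stc_set E S \<and> card S = l"
proof -
  define p q where "p j = y (g j)" and "q j = y (g (l + j))" for j
  have edge: "{p j, q j} \<in> E" if "j < l" for j
    using g that unfolding good_def p_def q_def by blast
  have pp: "{q j, q h} \<in> E" if "j < l" "h < l" "j \<noteq> h" "p j = p h" for j h
    using g that unfolding good_def p_def q_def by blast
  have pq: "{q j, p h} \<in> E" if "j < l" "h < l" "j \<noteq> h" "p j = q h" for j h
    using g that unfolding good_def p_def q_def by blast
  have qq: "{p j, p h} \<in> E" if "j < l" "h < l" "j \<noteq> h" "q j = q h" for j h
    using g that unfolding good_def p_def q_def by blast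
  define S where "S = (\<lambda>j. {p j, q j}) ` {..<l}"
  have "inj_on (\<lambda>j. {p j, q j}) {..<l}"
  proof (rule inj_onI)
    fix j h assume jh: "j \<in> {..<l}" "h \<in> {..<l}" "{p j, q j} = {p h, q h}"
    show "j = h"
    proof (rule ccontr)
      assume "j \<noteq> h"
      with jh pp[of j h] pq[of j h] ugraph_irrefl[OF G] show False
        by (auto simp: doubleton_eq_iff)
    qed
  qed
  then have "card S = l" unfolding S_def by (simp add: card_image)
  moreover have "stc_set E S"
    unfolding stc_set_def
  proof (intro conjI allI impI)
    show "S \<subseteq> E" unfolding S_def using edge by auto
    fix u v w assume uw: "u \<noteq> w" and uv: "{u, v} \<in> S" and vw: "{v, w} \<in> S"
    from uv vw obtain j h where jh: "j < l" "h < l" "{u, v} = {p j, q j}" "{v, w} = {p h, q h}"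
      unfolding S_def by auto
    with uw have "j \<noteq> h" by (auto simp: doubleton_eq_iff)
    \<comment> \<open>Four ways to share \<open>v\<close>; the case \<open>q j = p h\<close> is the
      condition \<open>pq\<close> with \<open>j\<close> and \<open>h\<close> exchanged.\<close>
    then show "{u, w} \<in> E"
      using jh pp[of j h] pq[of j h] pq[of h j] qq[of j h]
      by (auto simp: doubleton_eq_iff insert_commute)
  qed
  ultimately show ?thesis by blast
qed

text \<open>The exchange argument: replacing a vertex by the least admissible one makes its rank
  among the candidates at most the number of forbidden vertices.\<close>

lemma distinct_small_rank:
  fixes C :: "'b \<Rightarrow> nat set"
  assumes fin: "finite Y" "finite A" and N: "card A + card Y \<le> N"
    and inj: "inj_on r Y" and A: "r ` Y \<inter> A = {}" and C: "\<And>y. y \<in> Y \<Longrightarrow> r y \<in> C y"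
  shows "\<exists>r. inj_on r Y \<and> r ` Y \<inter> A = {} \<and>
    (\<forall>y\<in>Y. r y \<in> C y \<and> card {u. u < r y \<and> u \<in> C y} < N)"
proof -
  \<comment> \<open>Elements of \<open>Y\<close> are treated one by one, \<open>D\<close> being
    those already done. The sets \<open>C y\<close> do not depend on \<open>r\<close>, so a later
    replacement leaves earlier ranks intact.\<close>
  have "\<exists>r. inj_on r Y \<and> r ` Y \<inter> A = {} \<and> (\<forall>y\<in>Y. r y \<in> C y) \<and>
    (\<forall>y\<in>D. card {u. u < r y \<and> u \<in> C y} < N)" if "finite D" "D \<subseteq> Y" for D
    using that
  proof (induction D rule: finite_induct)
    case empty
    then show ?case using inj A C by blast
  next
    case (insert y D)
    then obtain r where r: "inj_on r Y" "r ` Y \<inter> A = {}" "\<forall>y\<in>Y. r y \<in> C y"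
      "\<forall>y\<in>D. card {u. u < r y \<and> u \<in> C y} < N" by auto
    from insert have y: "y \<in> Y" "y \<notin> D" by auto
    define F where "F = A \<union> r ` (Y - {y})"
    define z where "z = (LEAST z. z \<in> C y \<and> z \<notin> F)"
    have "r y \<notin> F" using r(1,2) y by (auto simp: F_def inj_on_def)
    with r(3) y have "r y \<in> C y \<and> r y \<notin> F" by blast
    then have z: "z \<in> C y \<and> z \<notin> F" unfolding z_def by (rule LeastI)
    have finF: "finite F" unfolding F_def using fin by simp
    \<comment> \<open>By minimality of \<open>z\<close> every smaller element of \<open>C y\<close>
      is forbidden, so the rank counts forbidden elements only.\<close>
    have "{u. u < z \<and> u \<in> C y} \<subseteq> F" unfolding z_def using not_less_Least by blast
    then have "card {u. u < z \<and> u \<in> C y} \<le> card F" by (rule card_mono[OF finF])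
    also have "\<dots> \<le> card A + card (Y - {y})"
      unfolding F_def using fin by (meson card_Un_le card_image_le finite_Diff le_trans add_left_mono)
    \<comment> \<open>Removing \<open>y\<close> from \<open>Y\<close> makes the bound
      strict.\<close>
    also have "\<dots> < N" using N fin y card_Diff1_less[of Y y] by linarith
    finally have rank: "card {u. u < z \<and> u \<in> C y} < N" .
    have "inj_on (r(y := z)) Y"
      using r(1) z unfolding F_def by (auto simp: inj_on_def)
    moreover have "(r(y := z)) ` Y \<inter> A = {}"
      using r(2) z unfolding F_def by auto
    moreover have "\<forall>y'\<in>Y. (r(y := z)) y' \<in> C y'" using r(3) z by auto
    moreover have "\<forall>y'\<in>insert y D. card {u. u < (r(y := z)) y' \<and> u \<in> C y'} < N"
      using r(4) rank y by auto
    ultimately show ?case by blast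
  qed
  from this[OF fin(1) subset_refl] show ?thesis by blast
qed

text \<open>The digits of \<open>d\<close> are the labels of the ends of the edges of
  \<open>S\<close>, followed by the ranks of replacements for the outside ends. Every label that
  occurs in \<open>d\<close> has a candidate of the right rank, so all fillings agree where it
  matters.\<close>

lemma stc_set_imp_good:
  assumes G: "ugraph {..<n} E" and S: "stc_set E S" "card S = l" and c: "c < 2 * l"
    and cover: "\<And>e. e \<in> E \<Longrightarrow> \<exists>i<c. x i \<in> e"
  shows "\<exists>d. (\<forall>i<3 * l. d i < 3 * l) \<and> (\<forall>y. filled E n l x d y \<longrightarrow> good E l y d)"
proof -
  have SE: "S \<subseteq> E" using S by (simp add: stc_set_def)
  have finS: "finite S" using SE ugraph_finite[OF G] finite_subset by blast
  define X where "X = x ` {..<c}"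
  have finX: "finite X" and cardX: "card X \<le> c"
    unfolding X_def using card_image_le[of "{..<c}" x] by auto
  \<comment> \<open>Vertices outside \<open>X\<close> are pairwise nonadjacent; this later rules out
    two outside ends closing a strong path.\<close>
  have out: "u \<in> X \<or> v \<in> X" if "{u, v} \<in> E" for u v
    using cover[OF that] unfolding X_def by auto
  obtain e where e: "bij_betw e {..<l} S"
    using ex_bij_betw_nat_finite[OF finS] S(2) by (auto simp: atLeast0LessThan)
  \<comment> \<open>Edges are oriented with the first end in the cover. Outside vertices thus occur
    only as second ends, which is why \<open>cand\<close> looks for \<open>f\<close> only at
    positions \<open>l + j\<close>.\<close>
  have "\<exists>u v. e j = {u, v} \<and> u \<in> X \<and> v < n" if "j < l" for j
  proof -
    have eE: "e j \<in> E" using that e SE by (auto simp: bij_betw_def)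
    obtain i where i: "i < c" "x i \<in> e j" using cover[OF eE] by blast
    obtain v where "e j = {x i, v}" "v < n"
      using ugraph_edgeE[OF G eE i(2)] by blast
    with i show ?thesis unfolding X_def by blast
  qed
  then obtain p q where pq: "\<And>j. j < l \<Longrightarrow> e j = {p j, q j} \<and> p j \<in> X \<and> q j < n"
    by metis
  have edge: "{p j, q j} \<in> S" if "j < l" for j
    using pq[OF that] e that by (auto simp: bij_betw_def)
  have distinct: "{p j, q j} \<noteq> {p h, q h}" if "j < l" "h < l" "j \<noteq> h" for j h
    using e that pq by (metis bij_betw_imp_inj_on inj_onD lessThan_iff)
  have closed: "{u, w} \<in> E" if "{u, v} \<in> S" "{v, w} \<in> S" "u \<noteq> w" for u v w
    using S(1) that unfolding stc_set_def by blast
  have pp: "{q j, q h} \<in> E" if "j < l" "h < l" "j \<noteq> h" "p j = p h" for j h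
  proof (rule closed[of _ "p j"])
    show "{q j, p j} \<in> S" using edge[of j] that by (simp add: insert_commute)
    show "{p j, q h} \<in> S" using edge[of h] that by simp
    show "q j \<noteq> q h" using distinct[of j h] that by auto
  qed
  have pq': "{q j, p h} \<in> E" if "j < l" "h < l" "j \<noteq> h" "p j = q h" for j h
  proof (rule closed[of _ "p j"])
    show "{q j, p j} \<in> S" using edge[of j] that by (simp add: insert_commute)
    show "{p j, p h} \<in> S" using edge[of h] that by (simp add: insert_commute)
    show "q j \<noteq> p h" using distinct[of j h] that by auto
  qed
  have qq: "{p j, p h} \<in> E" if "j < l" "h < l" "j \<noteq> h" "q j = q h" for j h
  proof (rule closed[of _ "q j"])
    show "{p j, q j} \<in> S" using edge[of j] that by simp
    show "{q j, p h} \<in> S" using edge[of h] that by (simp add: insert_commute)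
    show "p j \<noteq> p h" using distinct[of j h] that by auto
  qed
  define Y where "Y = q ` {..<l} - X"
  have finY: "finite Y" and cardY: "card Y \<le> l"
    unfolding Y_def using card_mono[of "q ` {..<l}" "q ` {..<l} - X"] card_image_le[of "{..<l}" q]
    by auto
  obtain pos where pos: "bij_betw pos Y {..<card Y}"
    using ex_bij_betw_finite_nat[OF finY] by (auto simp: atLeast0LessThan)
  \<comment> \<open>\<open>x\<close> may list a vertex several times, so one of its indices is
    chosen. Outside vertices are numbered after the \<open>2 * l\<close> cover labels.\<close>
  define lab where
    "lab v = (if v \<in> X then (SOME i. i < c \<and> x i = v) else 2 * l + pos v)" for v
  have labX: "lab v < 2 * l" "x (lab v) = v" if "v \<in> X" for v
  proof -
    have "\<exists>i. i < c \<and> x i = v" using that unfolding X_def by auto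
    from someI_ex[OF this] that c show "lab v < 2 * l" "x (lab v) = v" unfolding lab_def by auto
  qed
  have labY: "2 * l \<le> lab v" "lab v < 3 * l" if "v \<in> Y" for v
  proof -
    have "pos v < card Y" using pos that by (auto simp: bij_betw_def)
    with cardY that show "2 * l \<le> lab v" "lab v < 3 * l" unfolding lab_def Y_def by auto
  qed
  have lab_inj: "u = v" if "u \<in> X \<union> Y" "v \<in> X \<union> Y" "lab u = lab v" for u v
  proof (cases "u \<in> X \<or> v \<in> X")
    case True
    with that labX labY show ?thesis by (metis UnE leD)
  next
    case False
    with that have "u \<in> Y" "v \<in> Y" "pos u = pos v" by (auto simp: lab_def)
    with pos show ?thesis by (auto simp: bij_betw_def inj_on_def)
  qed
  have pX: "p j \<in> X" if "j < l" for j using pq[OF that] by blast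
  have qXY: "q j \<in> X \<union> Y" if "j < l" for j using that unfolding Y_def by auto
  \<comment> \<open>\<open>cand\<close> reads only the positions below \<open>2 * l\<close>; beyond
    them the value is arbitrary.\<close>
  define d0 where "d0 i = (if i < l then lab (p i) else lab (q (i - l)))" for i
  define C where "C y = {v. v < n \<and> cand E l x d0 (lab y) v}" for y
  \<comment> \<open>By closure of \<open>S\<close> the original vertex is a candidate for its own
    label, so the exchange can start from \<open>id\<close>.\<close>
  have candY: "y \<in> C y" if y: "y \<in> Y" for y
  proof -
    have "{y, x (d0 j)} \<in> E \<and> (d0 h = d0 j \<and> d0 (l + h) < 2 * l \<longrightarrow> {y, x (d0 (l + h))} \<in> E) \<and>
      (d0 (l + h) = d0 j \<longrightarrow> {y, x (d0 h)} \<in> E)"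
      if jh: "j < l" "h < l" "d0 (l + j) = lab y" for j h
    proof -
      have yX: "y \<notin> X" using y by (simp add: Y_def)
      have qy: "q j = y" using lab_inj[of "q j" y] qXY[OF jh(1)] y jh by (simp add: d0_def)
      have x0: "x (d0 j) = p j" "x (d0 h) = p h"
        using jh labX pX by (simp_all add: d0_def)
      have 1: "{y, x (d0 j)} \<in> E"
        using edge[OF jh(1)] SE qy x0 by (auto simp: insert_commute)
      have 2: "{y, x (d0 (l + h))} \<in> E" if "d0 h = d0 j" "d0 (l + h) < 2 * l"
      proof -
        have "p h = p j" using that(1) x0 by metis
        moreover have qX: "q h \<in> X" using that(2) qXY[OF jh(2)] labY[of "q h"] jh by (auto simp: d0_def)
        moreover have "j \<noteq> h" using qX yX qy by auto
        ultimately have "{y, q h} \<in> E" using pp[of j h] jh qy by auto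
        then show ?thesis using labX[OF qX] jh by (simp add: d0_def)
      qed
      have 3: "{y, x (d0 h)} \<in> E" if "d0 (l + h) = d0 j"
      proof -
        have "q h = p j"
          using lab_inj[of "q h" "p j"] qXY[OF jh(2)] pX[OF jh(1)] that jh by (simp add: d0_def)
        moreover then have "j \<noteq> h" using pX[OF jh(1)] qy yX by auto
        ultimately show ?thesis using pq'[of j h] jh qy x0 by simp
      qed
      from 1 2 3 show ?thesis by blast
    qed
    then have "cand E l x d0 (lab y) y" unfolding cand_def by blast
    moreover have "y < n" using y pq unfolding Y_def by auto
    ultimately show ?thesis unfolding C_def by simp
  qed
  have "card X + card Y \<le> 3 * l" using cardX cardY c by linarith
  moreover have "inj_on id Y" "id ` Y \<inter> X = {}" by (auto simp: Y_def)
  moreover have "id y \<in> C y" if "y \<in> Y" for y using candY[OF that] by simp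
  ultimately have "\<exists>r. inj_on r Y \<and> r ` Y \<inter> X = {} \<and>
    (\<forall>y\<in>Y. r y \<in> C y \<and> card {u. u < r y \<and> u \<in> C y} < 3 * l)"
    by (rule distinct_small_rank[OF finY finX])
  then obtain r where r: "inj_on r Y" "r ` Y \<inter> X = {}"
      "\<And>y. y \<in> Y \<Longrightarrow> r y \<in> C y" "\<And>y. y \<in> Y \<Longrightarrow> card {u. u < r y \<and> u \<in> C y} < 3 * l"
    by blast
  \<comment> \<open>Labels carried by no vertex of \<open>Y\<close> get the filler digit 0.\<close>
  define d where "d i = (if i < 2 * l then d0 i
    else if \<exists>y\<in>Y. lab y = i then let y = (THE y. y \<in> Y \<and> lab y = i) in card {u. u < r y \<and> u \<in> C y}
    else 0)" for i
  have dlab: "d (lab y) = card {u. u < r y \<and> u \<in> C y}" if "y \<in> Y" for y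
  proof -
    have "(THE y'. y' \<in> Y \<and> lab y' = lab y) = y"
      using that lab_inj by (intro the_equality) auto
    with that labY[OF that] show ?thesis unfolding d_def by (auto simp: Let_def)
  qed
  have dp: "d j = lab (p j)" and dq: "d (l + j) = lab (q j)" if "j < l" for j
    using that by (auto simp: d_def d0_def)
  \<comment> \<open>Writing the ranks into the last \<open>l\<close> digits does not change the
    candidates, so ranks may be computed from \<open>d0\<close>.\<close>
  have cand_d: "cand E l x d = cand E l x d0"
    unfolding cand_def by (intro ext) (simp add: dp dq d0_def)
  have "d i < 3 * l" if "i < 3 * l" for i
  proof (cases "i < 2 * l")
    case True
    show ?thesis
    proof (cases "i < l")
      case True
      with dp[OF True] labX[OF pX[OF True]] show ?thesis by simp
    next
      case False
      with True have "i - l < l" "i = l + (i - l)" by auto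
      then have "d i = lab (q (i - l))" using dq[of "i - l"] by simp
      moreover have "q (i - l) \<in> X \<or> q (i - l) \<in> Y" using qXY \<open>i - l < l\<close> by blast
      ultimately show ?thesis using labX(1)[of "q (i - l)"] labY(2)[of "q (i - l)"] by auto
    qed
  next
    case False
    show ?thesis
    proof (cases "\<exists>y\<in>Y. lab y = i")
      case True
      then show ?thesis using dlab r(4) by auto
    next
      case F: False
      with False that show ?thesis unfolding d_def by simp
    qed
  qed
  moreover have "good E l y d" if "filled E n l x d y" for y
  proof -
    have yx: "y i = x i" if "i < 2 * l" for i
      using \<open>filled E n l x d y\<close> that unfolding filled_def by blast
    have yp: "y (d j) = p j" if "j < l" for j
      using yx[of "lab (p j)"] labX[OF pX[OF that]] dp[OF that] by simp
    have yqX: "y (d (l + j)) = q j" if "j < l" "q j \<in> X" for j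
      using yx[of "lab (q j)"] labX[OF that(2)] dq[OF that(1)] by simp
    have yqY: "y (d (l + j)) = r (q j)" if "j < l" "q j \<in> Y" for j
    proof -
      let ?v = "r (q j)"
      have v: "?v < n" "cand E l x d (lab (q j)) ?v"
        using r(3)[OF that(2)] unfolding C_def cand_d by auto
      \<comment> \<open>\<open>C\<close> also demands \<open>u < n\<close>, whereas
        \<open>filled\<close> counts all smaller candidates; the counts agree because
        \<open>?v < n\<close>.\<close>
      have "{u. u < ?v \<and> u \<in> C (q j)} = {u. u < ?v \<and> cand E l x d (lab (q j)) u}"
        unfolding C_def cand_d using v(1) by auto
      then have "card {u. u < ?v \<and> cand E l x d (lab (q j)) u} = d (lab (q j))"
        using dlab[OF that(2)] by simp
      with v labY[OF that(2)] \<open>filled E n l x d y\<close> have "y (lab (q j)) = ?v"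
        unfolding filled_def by blast
      then show ?thesis using dq that by simp
    qed
    have rX: "r v \<notin> X" if "v \<in> Y" for v using r(2) that by auto
    have rc: "{r (q j), p j} \<in> E \<and> (p h = p j \<and> q h \<in> X \<longrightarrow> {r (q j), q h} \<in> E) \<and>
      (q h = p j \<longrightarrow> {r (q j), p h} \<in> E)" if "j < l" "h < l" "q j \<in> Y" for j h
    proof -
      have *: "cand E l x d (lab (q j)) (r (q j))"
        using r(3)[OF that(3)] unfolding C_def cand_d by auto
      have "{r (q j), x (d j)} \<in> E \<and>
         (d h = d j \<and> d (l + h) < 2 * l \<longrightarrow> {r (q j), x (d (l + h))} \<in> E) \<and>
         (d (l + h) = d j \<longrightarrow> {r (q j), x (d h)} \<in> E)"
        using *[unfolded cand_def, rule_format, OF that(1,2) dq[OF that(1)]] by blast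
      then show ?thesis
        using that dp dq labX pX by auto
    qed
    show ?thesis
      unfolding good_def
    proof (intro allI impI conjI)
      fix j h assume jh: "j < l" "h < l"
      show "{y (d j), y (d (l + j))} \<in> E"
        using qXY[OF jh(1)] yp[OF jh(1)] yqX[OF jh(1)] yqY[OF jh(1)] rc[OF jh(1) jh(1)] edge[OF jh(1)] SE
        by (auto simp: insert_commute)
      assume ne: "j \<noteq> h"
      show "{y (d (l + j)), y (d (l + h))} \<in> E" if "y (d j) = y (d h)"
      proof -
        have p: "p j = p h" using that yp jh by simp
        have qE: "{q j, q h} \<in> E" using pp[OF jh ne p] .
        \<comment> \<open>Two outside ends are impossible, as \<open>q j\<close> and
          \<open>q h\<close> are adjacent. In the mixed cases the closing edge belongs to the
          candidacy of the replaced vertex, both edges sharing the cover vertex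
          \<open>p j\<close>.\<close>
        consider "q j \<in> X" "q h \<in> X" | "q j \<in> Y" "q h \<in> X" | "q j \<in> X" "q h \<in> Y"
          using out[OF qE] qXY[OF jh(1)] qXY[OF jh(2)] by blast
        then show ?thesis
        proof cases
          case 1
          then show ?thesis using yqX jh qE by simp
        next
          case 2
          then show ?thesis using yqX[OF jh(2)] yqY[OF jh(1)] rc[OF jh(1,2)] p by simp
        next
          case 3
          then show ?thesis
            using yqX[OF jh(1)] yqY[OF jh(2)] rc[OF jh(2,1)] p by (simp add: insert_commute)
        qed
      qed
      show "{y (d (l + j)), y (d h)} \<in> E" if "y (d j) = y (d (l + h))"
      proof -
        \<comment> \<open>Replacements avoid the cover, so a second end that coincides with
          \<open>p j\<close> was in the cover from the start and has not moved.\<close>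
        have "y (d (l + h)) \<in> X" using that[symmetric] yp[OF jh(1)] pX[OF jh(1)] by simp
        then have "q h \<in> X" using qXY[OF jh(2)] yqY[OF jh(2)] rX by auto
        then have qh: "p j = q h" using that yp[OF jh(1)] yqX[OF jh(2)] by simp
        consider "q j \<in> X" | "q j \<in> Y" using qXY[OF jh(1)] by blast
        then show ?thesis
        proof cases
          case 1
          then show ?thesis using pq'[OF jh ne qh] yqX[OF jh(1)] yp[OF jh(2)] by simp
        next
          case 2
          then show ?thesis using qh[symmetric] rc[OF jh] yqY[OF jh(1)] yp[OF jh(2)] by simp
        qed
      qed
      show "{y (d j), y (d h)} \<in> E" if eq: "y (d (l + j)) = y (d (l + h))"
      proof -
        consider "q j \<in> X" "q h \<in> X" | "q j \<in> Y" "q h \<in> Y"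
          | "q j \<in> Y" "q h \<in> X" | "q j \<in> X" "q h \<in> Y"
          using qXY[OF jh(1)] qXY[OF jh(2)] by blast
        \<comment> \<open>The replacement is injective and avoids the cover, so it creates no new
          coincidence of second ends; closure of \<open>S\<close> then applies to the original
          vertices.\<close>
        then have "q j = q h"
        proof cases
          case 1
          then show ?thesis using eq yqX jh by simp
        next
          case 2
          then have "r (q j) = r (q h)" using eq yqY jh by simp
          then show ?thesis using 2 r(1) by (simp add: inj_on_def)
        next
          case 3
          then have "r (q j) = q h" using eq yqX[OF jh(2)] yqY[OF jh(1)] by simp
          then show ?thesis using rX[OF 3(1)] 3(2) by simp
        next
          case 4
          then have "r (q h) = q j" using eq yqX[OF jh(1)] yqY[OF jh(2)] by simp
          then show ?thesis using rX[OF 4(2)] 4(1) by simp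
        qed
        then show ?thesis using qq[OF jh ne] yp jh by simp
      qed
    qed
  qed
  ultimately show ?thesis by blast
qed

section \<open>Timed weakest preconditions\<close>

text \<open>\<open>Q\<close> sees the exact running time. A stuck or diverging program has no run,
  so every \<open>wp\<close> fact includes termination and the absence of overflow.\<close>

definition wp :: "nat \<Rightarrow> com \<Rightarrow> state \<Rightarrow> (nat \<Rightarrow> state \<Rightarrow> bool) \<Rightarrow> bool" where
  "wp B c s Q \<longleftrightarrow> (\<exists>t s'. run B c s t s' \<and> Q t s')"

lemma wp_mono: "wp B c s Q \<Longrightarrow> (\<And>t s'. Q t s' \<Longrightarrow> R t s') \<Longrightarrow> wp B c s R"
  unfolding wp_def by blast

lemma wp_Skip: "wp B Skip s Q \<longleftrightarrow> Q 1 s"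
proof
  show "Q 1 s" if "wp B Skip s Q"
    using that unfolding wp_def by (auto elim!: run_SkipE)
  show "wp B Skip s Q" if "Q 1 s"
    using that run.Skip unfolding wp_def by blast
qed

lemma wp_Assign: "wp B (Assign x i e) s Q \<longleftrightarrow>
    fits B s i \<and> fits B s e \<and> Q (1 + cost i + cost e) (store s x (val s i) (val s e))"
proof
  show "fits B s i \<and> fits B s e \<and> Q (1 + cost i + cost e) (store s x (val s i) (val s e))"
    if "wp B (Assign x i e) s Q"
    using that unfolding wp_def by (auto elim!: run_AssignE)
  show "wp B (Assign x i e) s Q"
    if "fits B s i \<and> fits B s e \<and> Q (1 + cost i + cost e) (store s x (val s i) (val s e))"
    using that run.Assign unfolding wp_def by blast
qed

lemma wp_Seq: "wp B (Seq c1 c2) s Q \<longleftrightarrow> wp B c1 s (\<lambda>t1 s1. wp B c2 s1 (\<lambda>t2. Q (t1 + t2)))"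
proof
  show "wp B c1 s (\<lambda>t1 s1. wp B c2 s1 (\<lambda>t2. Q (t1 + t2)))" if "wp B (Seq c1 c2) s Q"
    using that unfolding wp_def by (auto elim!: run_SeqE)
  show "wp B (Seq c1 c2) s Q" if "wp B c1 s (\<lambda>t1 s1. wp B c2 s1 (\<lambda>t2. Q (t1 + t2)))"
    using that run.Seq unfolding wp_def by blast
qed

lemma wp_If: "wp B (If b c1 c2) s Q \<longleftrightarrow> fits B s b \<and>
    (if val s b \<noteq> 0 then wp B c1 s (\<lambda>t. Q (1 + cost b + t))
     else wp B c2 s (\<lambda>t. Q (1 + cost b + t)))"
proof (cases "val s b = 0")
  case True
  have "wp B c2 s (\<lambda>t. Q (1 + cost b + t))" "fits B s b" if "wp B (If b c1 c2) s Q"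
    using that True unfolding wp_def by (auto elim!: run_IfE)
  moreover have "wp B (If b c1 c2) s Q" if "wp B c2 s (\<lambda>t. Q (1 + cost b + t))" "fits B s b"
    using that run.IfFalse[OF _ True] unfolding wp_def by blast
  ultimately show ?thesis using True by auto
next
  case False
  have "wp B c1 s (\<lambda>t. Q (1 + cost b + t))" "fits B s b" if "wp B (If b c1 c2) s Q"
    using that False unfolding wp_def by (auto elim!: run_IfE)
  moreover have "wp B (If b c1 c2) s Q" if "wp B c1 s (\<lambda>t. Q (1 + cost b + t))" "fits B s b"
    using that run.IfTrue[OF _ False] unfolding wp_def by blast
  ultimately show ?thesis using False by auto
qed

lemmas wp_simps = wp_Skip wp_Assign wp_Seq wp_If store_def

text \<open>The variant \<open>m\<close> bounds the number of rounds, with one bound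
  \<open>T\<close> for all bodies; the extra 1 in \<open>m s + 1\<close> pays for the final failing
  test.\<close>

lemma wp_While:
  fixes m :: "state \<Rightarrow> nat"
  assumes "I s"
    and fits: "\<And>s. I s \<Longrightarrow> fits B s b"
    and step: "\<And>s. I s \<Longrightarrow> val s b \<noteq> 0 \<Longrightarrow> wp B c s (\<lambda>t s'. t \<le> T \<and> I s' \<and> m s' < m s)"
  shows "wp B (While b c) s
    (\<lambda>t s'. t \<le> (m s + 1) * (T + cost b + 1) \<and> I s' \<and> val s' b = 0)"
  using \<open>I s\<close>
proof (induction "m s" arbitrary: s rule: less_induct)
  case less
  show ?case
  proof (cases "val s b = 0")
    case True
    with run.WhileFalse[OF fits[OF less.prems]] less.prems show ?thesis
      unfolding wp_def by fastforce
  next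
    case False
    from step[OF less.prems False] obtain t1 s1
      where 1: "run B c s t1 s1" "t1 \<le> T" "I s1" "m s1 < m s" unfolding wp_def by blast
    from less.hyps[OF 1(4,3)] obtain t2 s2
      where 2: "run B (While b c) s1 t2 s2" "t2 \<le> (m s1 + 1) * (T + cost b + 1)"
        "I s2" "val s2 b = 0" unfolding wp_def by blast
    have "(m s1 + 1) * (T + cost b + 1) \<le> m s * (T + cost b + 1)"
      using 1(4) by (intro mult_le_mono1) simp
    with 1(2) 2(2) have "1 + cost b + t1 + t2 \<le> (m s + 1) * (T + cost b + 1)" by simp
    with run.WhileTrue[OF fits[OF less.prems] False 1(1) 2(1)] 2(3,4) show ?thesis
      unfolding wp_def by blast
  qed
qed

section \<open>Counting loops\<close>

abbreviation Var :: "string \<Rightarrow> exp" where "Var x \<equiv> Read x (Const 0)"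

definition For :: "string \<Rightarrow> exp \<Rightarrow> exp \<Rightarrow> com \<Rightarrow> com" where
  "For x a e c = Seq (Assign x (Const 0) a)
     (While (Bin Less (Var x) e) (Seq c (Assign x (Const 0) (Bin Add (Var x) (Const 1)))))"

text \<open>The body has to establish the invariant for the state after the increment, since
  \<open>I\<close> may mention the counter itself. The constant 10 consists of 6 units for the
  increment and 4 for the loop test around \<open>e\<close>.\<close>

lemma wp_For:
  assumes a: "fits B s a" "val s a = lo" "lo \<le> hi" and B: "hi \<le> B" "1 \<le> B"
    and init: "I lo (store s x 0 lo)"
    and e: "\<And>i s. i \<le> hi \<Longrightarrow> I i s \<Longrightarrow> s x 0 = i \<Longrightarrow> fits B s e \<and> val s e = hi"
    and step: "\<And>i s. lo \<le> i \<Longrightarrow> i < hi \<Longrightarrow> I i s \<Longrightarrow> s x 0 = i \<Longrightarrow>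
      wp B c s (\<lambda>t s'. t \<le> T \<and> s' x 0 = i \<and> I (Suc i) (store s' x 0 (Suc i)))"
  shows "wp B (For x a e c) s (\<lambda>t s'. t \<le> 2 + cost a + (hi - lo + 1) * (T + cost e + 10) \<and>
    I hi s' \<and> s' x 0 = hi)"
proof -
  let ?J = "\<lambda>s'. lo \<le> s' x 0 \<and> s' x 0 \<le> hi \<and> I (s' x 0) s'"
  have W: "wp B (While (Bin Less (Var x) e) (Seq c (Assign x (Const 0) (Bin Add (Var x) (Const 1)))))
    (store s x 0 lo)
    (\<lambda>t s'. t \<le> (hi - (store s x 0 lo) x 0 + 1) * ((T + 6) + cost (Bin Less (Var x) e) + 1) \<and>
      ?J s' \<and> val s' (Bin Less (Var x) e) = 0)"
  proof (rule wp_While[where m = "\<lambda>s. hi - s x 0" and I = ?J])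
    show "?J (store s x 0 lo)" using init a by (simp add: store_def)
    show "fits B s (Bin Less (Var x) e)" if "?J s" for s
      using that e[of "s x 0" s] B by auto
    fix s assume J: "?J s" and v: "val s (Bin Less (Var x) e) \<noteq> 0"
    then have lt: "s x 0 < hi" using e[of "s x 0" s] by (auto split: if_splits)
    show "wp B (Seq c (Assign x (Const 0) (Bin Add (Var x) (Const 1)))) s
      (\<lambda>t s'. t \<le> T + 6 \<and> ?J s' \<and> hi - s' x 0 < hi - s x 0)"
      unfolding wp_Seq
      by (rule wp_mono[OF step[of "s x 0" s]]) (use J lt B in \<open>auto simp: wp_simps\<close>)
  qed
  have "wp B (While (Bin Less (Var x) e) (Seq c (Assign x (Const 0) (Bin Add (Var x) (Const 1)))))
    (store s x 0 lo) (\<lambda>t s'. (1 + cost (Const 0) + cost a) + t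
      \<le> 2 + cost a + (hi - lo + 1) * (T + cost e + 10) \<and> I hi s' \<and> s' x 0 = hi)"
  proof (rule wp_mono[OF W])
    fix t s'
    assume *: "t \<le> (hi - store s x 0 lo x 0 + 1) * (T + 6 + cost (Bin Less (Var x) e) + 1) \<and>
      ?J s' \<and> val s' (Bin Less (Var x) e) = 0"
    then have "s' x 0 = hi" using e[of "s' x 0" s'] by (auto split: if_splits)
    moreover have "(hi - store s x 0 lo x 0 + 1) * (T + 6 + cost (Bin Less (Var x) e) + 1) =
      (hi - lo + 1) * (T + cost e + 10)" by (simp add: store_def)
    ultimately show "(1 + cost (Const 0) + cost a) + t
      \<le> 2 + cost a + (hi - lo + 1) * (T + cost e + 10) \<and> I hi s' \<and> s' x 0 = hi"
      using * by simp
  qed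
  then show ?thesis
    unfolding For_def wp_Seq wp_Assign using a by simp
qed

section \<open>Frames, truth values and bounded quantifiers\<close>

definition frame :: "string set \<Rightarrow> state \<Rightarrow> state \<Rightarrow> bool" where
  "frame A s s' \<longleftrightarrow> (\<forall>y. y \<notin> A \<longrightarrow> s' y = s y)"

lemma frameD: "frame A s s' \<Longrightarrow> y \<notin> A \<Longrightarrow> s' y = s y"
  by (simp add: frame_def)

text \<open>Truth values are 0 and 1, so that \<open>Mul\<close> acts as conjunction. It does not
  short-circuit: operands must fit into a word even where their value is irrelevant.\<close>

definition tst :: "nat \<Rightarrow> state \<Rightarrow> exp \<Rightarrow> bool \<Rightarrow> bool" where
  "tst B s e P \<longleftrightarrow> fits B s e \<and> val s e = (if P then 1 else 0)"

definition Not_exp :: "exp \<Rightarrow> exp" where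
  "Not_exp e = Bin Eq e (Const 0)"

definition Imp_exp :: "exp \<Rightarrow> exp \<Rightarrow> exp" where
  "Imp_exp p q = Not_exp (Bin Mul p (Not_exp q))"

lemma tst_Less: "fits B s p \<Longrightarrow> fits B s q \<Longrightarrow> 1 \<le> B \<Longrightarrow> tst B s (Bin Less p q) (val s p < val s q)"
  by (simp add: tst_def)

lemma tst_Eq: "fits B s p \<Longrightarrow> fits B s q \<Longrightarrow> 1 \<le> B \<Longrightarrow> tst B s (Bin Eq p q) (val s p = val s q)"
  by (simp add: tst_def)

lemma tst_Mul: "tst B s p P \<Longrightarrow> tst B s q Q \<Longrightarrow> 1 \<le> B \<Longrightarrow> tst B s (Bin Mul p q) (P \<and> Q)"
  by (simp add: tst_def)

lemma tst_Not: "tst B s p P \<Longrightarrow> 1 \<le> B \<Longrightarrow> tst B s (Not_exp p) (\<not> P)"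
  by (simp add: tst_def Not_exp_def)

lemma tst_Imp: "tst B s p P \<Longrightarrow> tst B s q Q \<Longrightarrow> 1 \<le> B \<Longrightarrow> tst B s (Imp_exp p q) (P \<longrightarrow> Q)"
  by (simp add: tst_def Imp_exp_def Not_exp_def)

definition All_loop :: "exp \<Rightarrow> exp \<Rightarrow> com" where
  "All_loop hi e = Seq (Assign ''ok'' (Const 0) (Const 1))
     (For ''w'' (Const 0) hi (If e Skip (Assign ''ok'' (Const 0) (Const 0))))"

text \<open>The final state is given exactly, so that facts about all other arrays carry over by
  rewriting. The hypotheses range over both counter and flag values because the loop changes only
  these two.\<close>

lemma wp_All_loop:
  assumes B: "N \<le> B" "1 \<le> B"
    and hi: "\<And>j b. fits B (store (store s ''ok'' 0 b) ''w'' 0 j) hi"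
      "\<And>j b. val (store (store s ''ok'' 0 b) ''w'' 0 j) hi = N"
    and e: "\<And>j b. j < N \<Longrightarrow> tst B (store (store s ''ok'' 0 b) ''w'' 0 j) e (P j)"
  shows "wp B (All_loop hi e) s (\<lambda>t s'. t \<le> 6 + (N + 1) * (cost e + cost hi + 14) \<and>
    s' = store (store s ''ok'' 0 (if \<forall>j<N. P j then 1 else 0)) ''w'' 0 N)"
proof -
  define st where "st j b = store (store s ''ok'' 0 b) ''w'' 0 j" for j b
  have w: "st j b ''w'' 0 = j" for j b by (simp add: st_def store_def)
  have st_w: "store (st j b) ''w'' 0 i = st i b" for i j b by (simp add: st_def store_def)
  have st_ok: "store (st j b) ''ok'' 0 a = st j a" for a j b
    by (simp add: st_def store_def fun_eq_iff)
  have hi': "fits B (st j b) hi" "val (st j b) hi = N" for j b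
    by (simp_all add: st_def hi)
  have e': "fits B (st j b) e" "val (st j b) e = (if P j then 1 else 0)" if "j < N" for j b
    using e[OF that, of b] by (simp_all add: tst_def st_def)
  define Q where "Q i = (if \<forall>j<i. P j then 1 else (0 :: nat))" for i
  have Q_Suc: "Q (Suc i) = (if P i then Q i else 0)" for i
    unfolding Q_def by (auto simp: less_Suc_eq)
  have "wp B (For ''w'' (Const 0) hi (If e Skip (Assign ''ok'' (Const 0) (Const 0))))
     (store s ''ok'' 0 1)
     (\<lambda>t s'. t \<le> 2 + cost (Const 0) + (N - 0 + 1) * ((cost e + 4) + cost hi + 10) \<and>
        s' = st N (Q N) \<and> s' ''w'' 0 = N)"
  proof (rule wp_For)
    show "store (store s ''ok'' 0 1) ''w'' 0 0 = st 0 (Q 0)" by (simp add: st_def Q_def)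
    show "fits B s' hi \<and> val s' hi = N" if "s' = st i (Q i)" for i s'
      using hi' that by simp
    show "wp B (If e Skip (Assign ''ok'' (Const 0) (Const 0))) s'
      (\<lambda>t s'. t \<le> cost e + 4 \<and> s' ''w'' 0 = i \<and> store s' ''w'' 0 (Suc i) = st (Suc i) (Q (Suc i)))"
      if "i < N" "s' = st i (Q i)" for i s'
      using e'[OF that(1)] that by (simp add: wp_Skip wp_Assign wp_If w st_w st_ok Q_Suc)
  qed (use B in simp_all)
  then have "wp B (For ''w'' (Const 0) hi (If e Skip (Assign ''ok'' (Const 0) (Const 0))))
     (store s ''ok'' 0 1) (\<lambda>t s'. (1 + cost (Const 0) + cost (Const 1)) + t
        \<le> 6 + (N + 1) * (cost e + cost hi + 14) \<and> s' = st N (Q N))"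
    by (rule wp_mono) (simp add: algebra_simps)
  then show ?thesis
    unfolding All_loop_def wp_Seq wp_Assign st_def Q_def using B by simp
qed

section \<open>Adjacency tests\<close>

text \<open>The bounds on \<open>x\<close> and \<open>g\<close> range over all cells: a wrong guess
  may look up cells that were never written, which hold 0. The inequalities for \<open>B\<close>
  serve matrix indices, pair counters, digits and constants.\<close>

definition env :: "nat \<Rightarrow> nat \<Rightarrow> nat \<Rightarrow> nat set set \<Rightarrow> state \<Rightarrow> bool" where
  "env B n l E s \<longleftrightarrow> s ''n'' 0 = n \<and> s ''l'' 0 = l \<and> 1 \<le> n \<and> 1 \<le> l \<and>
     n * n \<le> B \<and> l * l \<le> B \<and> 3 * l \<le> B \<and> 3 \<le> B \<and>
     (\<forall>u<n. \<forall>v<n. s ''adj'' (u * n + v) = (if {u, v} \<in> E then 1 else 0)) \<and>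
     (\<forall>i. s ''x'' i < n) \<and> (\<forall>i. s ''g'' i < 3 * l)"

lemma env_cong:
  assumes "s' ''n'' = s ''n''" "s' ''l'' = s ''l''" "s' ''adj'' = s ''adj''" "s' ''x'' = s ''x''"
    "s' ''g'' = s ''g''"
  shows "env B n l E s' = env B n l E s"
  unfolding env_def assms ..

lemma env_store: "y \<notin> {''n'', ''l'', ''adj'', ''x'', ''g''} \<Longrightarrow> env B n l E (store s y i a) = env B n l E s"
  by (rule env_cong) (auto simp: store_def)

lemma env_frame:
  assumes "env B n l E s" "frame A s s'" "A \<inter> {''n'', ''l'', ''adj'', ''x'', ''g''} = {}"
  shows "env B n l E s'"
proof -
  have "env B n l E s' = env B n l E s"
    by (rule env_cong) (rule frameD[OF assms(2)], use assms(3) in blast)+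
  with assms(1) show ?thesis by simp
qed

lemma envD:
  assumes "env B n l E s"
  shows "s ''n'' 0 = n" "s ''l'' 0 = l" "1 \<le> n" "1 \<le> l" "n * n \<le> B" "l * l \<le> B" "3 * l \<le> B" "3 \<le> B"
    "s ''x'' i < n" "n \<le> B" "s ''g'' i < 3 * l"
proof -
  have "n \<le> n * n" by simp
  with assms show "s ''n'' 0 = n" "s ''l'' 0 = l" "1 \<le> n" "1 \<le> l" "n * n \<le> B" "l * l \<le> B" "3 * l \<le> B" "3 \<le> B"
    "s ''x'' i < n" "n \<le> B" "s ''g'' i < 3 * l"
    unfolding env_def by (blast intro: order_trans)+
qed

lemma mult_add_less:
  fixes u v n :: nat
  assumes "u < n" "v < n" shows "u * n + v < n * n"
proof -
  have "u * n + v < Suc u * n" using assms(2) by simp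
  also have "\<dots> \<le> n * n" using assms(1) by (intro mult_le_mono1) simp
  finally show ?thesis .
qed

definition adj_exp :: "exp \<Rightarrow> exp \<Rightarrow> exp" where
  "adj_exp p q = Read ''adj'' (Bin Add (Bin Mul p (Var ''n'')) q)"

lemma tst_adj:
  assumes "env B n l E s" "fits B s p" "fits B s q" "val s p < n" "val s q < n"
  shows "tst B s (adj_exp p q) ({val s p, val s q} \<in> E)"
proof -
  note e = envD[OF assms(1)]
  have "val s p * n + val s q \<le> B"
    using mult_add_less[OF assms(4,5)] e by simp
  moreover have "s ''adj'' (val s p * n + val s q) = (if {val s p, val s q} \<in> E then 1 else 0)"
    using assms unfolding env_def by simp
  ultimately show ?thesis
    using assms e unfolding tst_def adj_exp_def by auto
qed

section \<open>Testing all pairs of edge positions\<close>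

definition pair_fst :: exp where "pair_fst = Bin Div (Var ''w'') (Var ''l'')"
definition pair_snd :: exp where "pair_snd = Bin Mod (Var ''w'') (Var ''l'')"
definition label1 :: "exp \<Rightarrow> exp" where "label1 j = Read ''g'' j"
definition label2 :: "exp \<Rightarrow> exp" where "label2 j = Read ''g'' (Bin Add (Var ''l'') j)"

text \<open>Division with remainder by \<open>l\<close> lets one loop of \<open>l * l\<close> rounds
  replace two nested loops.\<close>

lemma pairs_iff:
  fixes l :: nat
  assumes "1 \<le> l"
  shows "(\<forall>w<l * l. P (w div l) (w mod l)) \<longleftrightarrow> (\<forall>j<l. \<forall>h<l. P j h)"
proof (intro iffI allI impI)
  fix j h assume *: "\<forall>w<l * l. P (w div l) (w mod l)" "j < l" "h < l"
  then show "P j h" using mult_add_less[of j l h] by (metis add.commute div_mult_self1 div_less add_0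
      mod_mult_self1 mod_less less_nat_zero_code)
next
  fix w assume *: "\<forall>j<l. \<forall>h<l. P j h" "w < l * l"
  then have "w div l < l" using less_mult_imp_div_less by blast
  with * assms show "P (w div l) (w mod l)" by simp
qed

lemma pair_exps:
  assumes "env B n l E s" "s ''w'' 0 < l * l"
  shows "fits B s pair_fst" "fits B s pair_snd" "val s pair_fst = s ''w'' 0 div l"
    "val s pair_snd = s ''w'' 0 mod l" "s ''w'' 0 div l < l" "s ''w'' 0 mod l < l"
proof -
  note e = envD[OF assms(1)]
  show 1: "s ''w'' 0 div l < l" using assms less_mult_imp_div_less by blast
  show 2: "s ''w'' 0 mod l < l" using e(4) by simp
  have le: "l \<le> B" "s ''w'' 0 \<le> B" "s ''w'' 0 div l \<le> B" "s ''w'' 0 mod l \<le> B"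
    using e(6,7) 1 2 assms(2) by linarith+
  show "val s pair_fst = s ''w'' 0 div l" "val s pair_snd = s ''w'' 0 mod l"
    using e(2) by (simp_all add: pair_fst_def pair_snd_def)
  show "fits B s pair_fst" "fits B s pair_snd"
    unfolding pair_fst_def pair_snd_def using le e(2) by simp_all
qed

lemma digit_exps:
  assumes "env B n l E s" "fits B s j" "val s j < l"
  shows "fits B s (label1 j)" "fits B s (label2 j)" "val s (label1 j) = s ''g'' (val s j)"
    "val s (label2 j) = s ''g'' (l + val s j)"
proof -
  note e = envD[OF assms(1)]
  have "s ''g'' (val s j) < 3 * l" "s ''g'' (l + val s j) < 3 * l" using e(11) assms(3) by simp_all
  with assms e(2,7,8) show "fits B s (label1 j)" "fits B s (label2 j)" "val s (label1 j) = s ''g'' (val s j)"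
    "val s (label2 j) = s ''g'' (l + val s j)"
    by (simp_all add: label1_def label2_def)
qed

text \<open>Without short-circuit evaluation \<open>x\<close> is also read at labels of outside
  vertices; every cell of \<open>x\<close> holds a vertex, so the matrix access stays in
  range.\<close>

definition cand_exp :: exp where
  "cand_exp = (let v = Var ''v''; j = pair_fst; h = pair_snd; x = Read ''x'' in
     Imp_exp (Bin Eq (label2 j) (Var ''f''))
       (Bin Mul (adj_exp v (x (label1 j)))
       (Bin Mul (Imp_exp (Bin Mul (Bin Eq (label1 h) (label1 j)) (Bin Less (label2 h) (Bin Mul (Const 2) (Var ''l''))))
                  (adj_exp v (x (label2 h))))
                (Imp_exp (Bin Eq (label2 h) (label1 j)) (adj_exp v (x (label1 h)))))))"

lemma tst_cand_exp:
  assumes env: "env B n l E s" and w: "s ''w'' 0 < l * l" and v: "s ''v'' 0 < n" and f: "s ''f'' 0 \<le> B"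
    and jh: "j = s ''w'' 0 div l" "h = s ''w'' 0 mod l"
  defines "x \<equiv> s ''x''" and "g \<equiv> s ''g''"
  shows "tst B s cand_exp (g (l + j) = s ''f'' 0 \<longrightarrow> {s ''v'' 0, x (g j)} \<in> E \<and>
     (g h = g j \<and> g (l + h) < 2 * l \<longrightarrow> {s ''v'' 0, x (g (l + h))} \<in> E) \<and>
     (g (l + h) = g j \<longrightarrow> {s ''v'' 0, x (g h)} \<in> E))"
proof -
  note e = envD[OF env]
  note p = pair_exps[OF env w]
  have dj: "fits B s (label1 pair_fst)" "fits B s (label2 pair_fst)" "val s (label1 pair_fst) = g j"
    "val s (label2 pair_fst) = g (l + j)"
    using digit_exps[OF env p(1)] p unfolding jh g_def by simp_all
  have dh: "fits B s (label1 pair_snd)" "fits B s (label2 pair_snd)" "val s (label1 pair_snd) = g h"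
    "val s (label2 pair_snd) = g (l + h)"
    using digit_exps[OF env p(2)] p unfolding jh g_def by simp_all
  have x: "fits B s (Read ''x'' i)" "val s (Read ''x'' i) < n" "val s (Read ''x'' i) = x (val s i)"
    if "fits B s i" for i
    using that e(9)[of "val s i"] e(10) by (simp_all add: x_def)
  have vv: "fits B s (Var ''v'')" "val s (Var ''v'') = s ''v'' 0" using v e(10) by simp_all
  have ff: "fits B s (Var ''f'')" "val s (Var ''f'') = s ''f'' 0" using f by simp_all
  have ll: "fits B s (Bin Mul (Const 2) (Var ''l''))" "val s (Bin Mul (Const 2) (Var ''l'')) = 2 * l"
    using e(2,7,8) by simp_all
  have B: "1 \<le> B" using e(8) by simp
  have a: "tst B s (adj_exp (Var ''v'') (Read ''x'' i)) ({s ''v'' 0, x (val s i)} \<in> E)"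
    if "fits B s i" for i
    using tst_adj[OF env vv(1) x(1)[OF that]] x[OF that] v vv(2) by simp
  note a' = a[OF dj(1), unfolded dj] a[OF dh(2), unfolded dh] a[OF dh(1), unfolded dh]
  note t = tst_Eq[OF dj(2) ff(1) B, unfolded dj ff] tst_Eq[OF dh(1) dj(1) B, unfolded dj dh]
    tst_Less[OF dh(2) ll(1) B, unfolded dh ll] tst_Eq[OF dh(2) dj(1) B, unfolded dh dj]
  show ?thesis
    unfolding cand_exp_def Let_def by (intro tst_Imp tst_Mul a' t B)
qed

definition check_exp :: exp where
  "check_exp = (let j = pair_fst; h = pair_snd; p = \<lambda>j. Read ''y'' (label1 j); q = \<lambda>j. Read ''y'' (label2 j) in
     Bin Mul (adj_exp (p j) (q j)) (Imp_exp (Not_exp (Bin Eq j h))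
       (Bin Mul (Imp_exp (Bin Eq (p j) (p h)) (adj_exp (q j) (q h)))
       (Bin Mul (Imp_exp (Bin Eq (p j) (q h)) (adj_exp (q j) (p h)))
                (Imp_exp (Bin Eq (q j) (q h)) (adj_exp (p j) (p h)))))))"

lemma tst_check_exp:
  assumes env: "env B n l E s" and w: "s ''w'' 0 < l * l" and yn: "\<forall>i. s ''y'' i < n"
    and jh: "j = s ''w'' 0 div l" "h = s ''w'' 0 mod l"
  defines "y \<equiv> s ''y''" and "g \<equiv> s ''g''"
  shows "tst B s check_exp ({y (g j), y (g (l + j))} \<in> E \<and> (j \<noteq> h \<longrightarrow>
     (y (g j) = y (g h) \<longrightarrow> {y (g (l + j)), y (g (l + h))} \<in> E) \<and>
     (y (g j) = y (g (l + h)) \<longrightarrow> {y (g (l + j)), y (g h)} \<in> E) \<and>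
     (y (g (l + j)) = y (g (l + h)) \<longrightarrow> {y (g j), y (g h)} \<in> E)))"
proof -
  note e = envD[OF env]
  note p = pair_exps[OF env w, folded jh]
  have B: "1 \<le> B" using e(8) by simp
  have y: "fits B s (Read ''y'' i)" "val s (Read ''y'' i) < n" "val s (Read ''y'' i) = y (val s i)"
    if "fits B s i" for i
    using that yn e(10) by (simp_all add: y_def) (meson less_imp_le order_trans)
  note dj = digit_exps[OF env p(1), unfolded p(3), OF p(5), folded g_def]
  note dh = digit_exps[OF env p(2), unfolded p(4), OF p(6), folded g_def]
  have a: "tst B s (adj_exp (Read ''y'' i) (Read ''y'' k)) ({y (val s i), y (val s k)} \<in> E)"
    and eq: "tst B s (Bin Eq (Read ''y'' i) (Read ''y'' k)) (y (val s i) = y (val s k))"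
    if "fits B s i" "fits B s k" for i k
    using tst_adj[OF env y(1)[OF that(1)] y(1)[OF that(2)]] y[OF that(1)] y[OF that(2)]
      tst_Eq[OF y(1)[OF that(1)] y(1)[OF that(2)] B] by simp_all
  note a' = a[OF dj(1,2), unfolded dj] a[OF dj(2) dh(2), unfolded dj dh]
    a[OF dj(2) dh(1), unfolded dj dh] a[OF dj(1) dh(1), unfolded dj dh]
  note eq' = eq[OF dj(1) dh(1), unfolded dj dh] eq[OF dj(1) dh(2), unfolded dj dh]
    eq[OF dj(2) dh(2), unfolded dj dh]
  note ne = tst_Not[OF tst_Eq[OF p(1,2) B, unfolded p(3,4)] B]
  show ?thesis
    unfolding check_exp_def Let_def by (intro tst_Imp tst_Mul a' eq' ne B)
qed

definition pairs_exp :: exp where "pairs_exp = Bin Mul (Var ''l'') (Var ''l'')"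

lemma pairs_exp:
  "env B n l E s \<Longrightarrow> fits B s pairs_exp" "env B n l E s \<Longrightarrow> val s pairs_exp = l * l"
  using envD[of B n l E s] by (simp_all add: pairs_exp_def)

text \<open>The expressions have constant size, so a pass over \<open>K\<close> pairs is linear in
  \<open>K\<close>; \<open>1 \<le> K\<close> absorbs the additive constants.\<close>

lemma cost_cand_exp:
  "1 \<le> K \<Longrightarrow> 6 + (K + 1) * (cost cand_exp + cost pairs_exp + 14) \<le> 1000 * K"
  by (simp add: cand_exp_def pairs_exp_def Let_def label1_def label2_def adj_exp_def Imp_exp_def
      Not_exp_def pair_fst_def pair_snd_def)

lemma cost_check_exp:
  "1 \<le> K \<Longrightarrow> 6 + (K + 1) * (cost check_exp + cost pairs_exp + 14) \<le> 1000 * K"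
  by (simp add: check_exp_def pairs_exp_def Let_def label1_def label2_def adj_exp_def Imp_exp_def
      Not_exp_def pair_fst_def pair_snd_def)

lemma wp_cand:
  assumes env: "env B n l E s" and v: "s ''v'' 0 < n" and f: "s ''f'' 0 \<le> B"
  shows "wp B (All_loop pairs_exp cand_exp) s (\<lambda>t s'. t \<le> 1000 * (l * l) \<and>
    s' = store (store s ''ok'' 0 (if cand E l (s ''x'') (s ''g'') (s ''f'' 0) (s ''v'' 0) then 1 else 0))
      ''w'' 0 (l * l))"
proof -
  let ?s = "\<lambda>b j. store (store s ''ok'' 0 b) ''w'' 0 j"
  have env': "env B n l E (?s b j)" for b j using env by (simp add: env_store)
  let ?P = "\<lambda>j h. s ''g'' (l + j) = s ''f'' 0 \<longrightarrow> {s ''v'' 0, s ''x'' (s ''g'' j)} \<in> E \<and>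
     (s ''g'' h = s ''g'' j \<and> s ''g'' (l + h) < 2 * l \<longrightarrow> {s ''v'' 0, s ''x'' (s ''g'' (l + h))} \<in> E) \<and>
     (s ''g'' (l + h) = s ''g'' j \<longrightarrow> {s ''v'' 0, s ''x'' (s ''g'' h)} \<in> E)"
  have "wp B (All_loop pairs_exp cand_exp) s (\<lambda>t s'. t \<le> 6 + (l * l + 1) * (cost cand_exp + cost pairs_exp + 14) \<and>
    s' = ?s (if \<forall>w<l * l. ?P (w div l) (w mod l) then 1 else 0) (l * l))"
  proof (rule wp_All_loop)
    fix j b assume "j < l * l"
    then show "tst B (?s b j) cand_exp (?P (j div l) (j mod l))"
      using tst_cand_exp[OF env' _ _ _ refl refl, of b j] v f by (simp add: store_def)
  qed (use envD(6,8)[OF env] pairs_exp[OF env'] in simp_all)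
  moreover have "(\<forall>w<l * l. ?P (w div l) (w mod l)) \<longleftrightarrow> cand E l (s ''x'') (s ''g'') (s ''f'' 0) (s ''v'' 0)"
    unfolding cand_def using envD(4)[OF env] by (rule pairs_iff)
  moreover have "6 + (l * l + 1) * (cost cand_exp + cost pairs_exp + 14) \<le> 1000 * (l * l)"
    using envD(4)[OF env] by (intro cost_cand_exp) simp
  ultimately show ?thesis by (auto elim!: wp_mono)
qed

lemma wp_check:
  assumes env: "env B n l E s" and y: "\<forall>i. s ''y'' i < n"
  shows "wp B (All_loop pairs_exp check_exp) s (\<lambda>t s'. t \<le> 1000 * (l * l) \<and>
    s' = store (store s ''ok'' 0 (if good E l (s ''y'') (s ''g'') then 1 else 0)) ''w'' 0 (l * l))"
proof -
  let ?s = "\<lambda>b j. store (store s ''ok'' 0 b) ''w'' 0 j"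
  have env': "env B n l E (?s b j)" for b j using env by (simp add: env_store)
  let ?y = "s ''y''" and ?g = "s ''g''"
  let ?P = "\<lambda>j h. {?y (?g j), ?y (?g (l + j))} \<in> E \<and> (j \<noteq> h \<longrightarrow>
     (?y (?g j) = ?y (?g h) \<longrightarrow> {?y (?g (l + j)), ?y (?g (l + h))} \<in> E) \<and>
     (?y (?g j) = ?y (?g (l + h)) \<longrightarrow> {?y (?g (l + j)), ?y (?g h)} \<in> E) \<and>
     (?y (?g (l + j)) = ?y (?g (l + h)) \<longrightarrow> {?y (?g j), ?y (?g h)} \<in> E))"
  have "wp B (All_loop pairs_exp check_exp) s (\<lambda>t s'. t \<le> 6 + (l * l + 1) * (cost check_exp + cost pairs_exp + 14) \<and>
    s' = ?s (if \<forall>w<l * l. ?P (w div l) (w mod l) then 1 else 0) (l * l))"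
  proof (rule wp_All_loop)
    fix j b assume "j < l * l"
    then show "tst B (?s b j) check_exp (?P (j div l) (j mod l))"
      using tst_check_exp[OF env' _ _ refl refl, of b j] y by (simp add: store_def)
  qed (use envD(6,8)[OF env] pairs_exp[OF env'] in simp_all)
  moreover have "(\<forall>w<l * l. ?P (w div l) (w mod l)) \<longleftrightarrow> good E l ?y ?g"
    unfolding good_def using envD(4)[OF env] by (rule pairs_iff)
  moreover have "6 + (l * l + 1) * (cost check_exp + cost pairs_exp + 14) \<le> 1000 * (l * l)"
    using envD(4)[OF env] by (intro cost_check_exp) simp
  ultimately show ?thesis by (auto elim!: wp_mono)
qed

section \<open>Choosing the outside vertices\<close>

definition rank :: "(nat \<Rightarrow> bool) \<Rightarrow> nat \<Rightarrow> nat" where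
  "rank P v = card {u. u < v \<and> P u}"

lemma rank_0: "rank P 0 = 0"
  by (simp add: rank_def)

lemma rank_Suc: "rank P (Suc v) = rank P v + (if P v then 1 else 0)"
proof -
  have "{u. u < Suc v \<and> P u} = {u. u < v \<and> P u} \<union> (if P v then {v} else {})"
    by (auto simp: less_Suc_eq)
  then show ?thesis by (simp add: rank_def)
qed

lemma rank_le: "rank P v \<le> v"
  by (induction v) (simp_all add: rank_0 rank_Suc)

lemma rank_mono: "u \<le> v \<Longrightarrow> rank P u \<le> rank P v"
  by (induction v rule: dec_induct) (simp_all add: rank_Suc)

text \<open>After the candidate of the guessed rank has been stored, the counter exceeds that rank,
  so no later vertex overwrites it.\<close>

lemma rank_strict_mono: "u < v \<Longrightarrow> P u \<Longrightarrow> rank P u < rank P v"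
  using rank_mono[of "Suc u" v P] by (simp add: rank_Suc)

definition pick_com :: com where
  "pick_com = Seq (All_loop pairs_exp cand_exp) (If (Var ''ok'')
     (Seq (If (Bin Eq (Var ''cnt'') (Read ''g'' (Var ''f''))) (Assign ''y'' (Var ''f'') (Var ''v'')) Skip)
       (Assign ''cnt'' (Const 0) (Bin Add (Var ''cnt'') (Const 1)))) Skip)"

lemma wp_pick:
  assumes env: "env B n l E s" and v: "s ''v'' 0 < n" and f: "f < 3 * l" "s ''f'' 0 = f" and y: "s ''y'' f < n"
    and cnt: "s ''cnt'' 0 = rank (cand E l (s ''x'') (s ''g'') f) (s ''v'' 0)"
  shows "wp B pick_com s (\<lambda>t s'. t \<le> 1100 * (l * l) \<and> frame {''ok'', ''w'', ''cnt'', ''y''} s s' \<and>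
    s' ''cnt'' 0 = rank (cand E l (s ''x'') (s ''g'') f) (Suc (s ''v'' 0)) \<and> s' ''y'' =
      (if cand E l (s ''x'') (s ''g'') f (s ''v'' 0) \<and> s ''cnt'' 0 = s ''g'' f
       then (s ''y'')(f := s ''v'' 0) else s ''y''))"
proof -
  note e = envD[OF env]
  let ?C = "cand E l (s ''x'') (s ''g'') f"
  have g: "s ''g'' f \<le> B" using e(11)[of f] e(7) by simp
  have B: "f \<le> B" "s ''v'' 0 \<le> B" "s ''y'' f \<le> B" "1 \<le> B"
    using f e v y by linarith+
  have c: "s ''cnt'' 0 \<le> B" "Suc (s ''cnt'' 0) \<le> B"
    using cnt rank_le[of ?C "s ''v'' 0"] v e(10) by linarith+
  have l: "1 \<le> l * l" using e(4) by simp
  show ?thesis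
    unfolding pick_com_def wp_Seq
  proof (rule wp_mono[OF wp_cand[OF env v]])
    show "s ''f'' 0 \<le> B" using f B by simp
    fix t s'
    assume *: "t \<le> 1000 * (l * l) \<and> s' = store (store s ''ok'' 0
      (if cand E l (s ''x'') (s ''g'') (s ''f'' 0) (s ''v'' 0) then 1 else 0)) ''w'' 0 (l * l)"
    then have tt: "t + 40 \<le> 1100 * (l * l)" using l by linarith
    show "wp B (If (Var ''ok'')
       (Seq (If (Bin Eq (Var ''cnt'') (Read ''g'' (Var ''f''))) (Assign ''y'' (Var ''f'') (Var ''v'')) Skip)
       (Assign ''cnt'' (Const 0) (Bin Add (Var ''cnt'') (Const 1)))) Skip) s'
       (\<lambda>u s'. t + u \<le> 1100 * (l * l) \<and> frame {''ok'', ''w'', ''cnt'', ''y''} s s' \<and>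
      s' ''cnt'' 0 = rank ?C (Suc (s ''v'' 0)) \<and> s' ''y'' =
      (if ?C (s ''v'' 0) \<and> s ''cnt'' 0 = s ''g'' f then (s ''y'')(f := s ''v'' 0) else s ''y''))"
      using * tt f g B c by (cases "?C (s ''v'' 0)")
        (simp_all add: wp_simps rank_Suc cnt[symmetric] frame_def)
  qed
qed

definition fill_com :: com where
  "fill_com = For ''f'' (Bin Mul (Const 2) (Var ''l'')) (Bin Mul (Const 3) (Var ''l''))
     (Seq (Assign ''cnt'' (Const 0) (Const 0)) (For ''v'' (Const 0) (Var ''n'') pick_com))"

text \<open>If no candidate has the guessed rank, \<open>y f\<close> keeps its old value; that it is
  still a vertex is all the final check needs to stay within the matrix.\<close>

lemma wp_fill_one:
  assumes env: "env B n l E s" and f: "f < 3 * l" "s ''f'' 0 = f" and y: "\<forall>i. s ''y'' i < n"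
  shows "wp B (Seq (Assign ''cnt'' (Const 0) (Const 0)) (For ''v'' (Const 0) (Var ''n'') pick_com)) s
    (\<lambda>t s'. t \<le> 2300 * (l * l * n) \<and> frame {''ok'', ''w'', ''cnt'', ''y'', ''v''} s s' \<and>
      (\<forall>i. i \<noteq> f \<longrightarrow> s' ''y'' i = s ''y'' i) \<and> s' ''y'' f < n \<and>
      (\<forall>v<n. cand E l (s ''x'') (s ''g'') f v \<and> rank (cand E l (s ''x'') (s ''g'') f) v = s ''g'' f
         \<longrightarrow> s' ''y'' f = v))"
proof -
  note e = envD[OF env]
  let ?C = "cand E l (s ''x'') (s ''g'') f"
  let ?F = "frame {''ok'', ''w'', ''cnt'', ''y'', ''v''} s"
  let ?I = "\<lambda>k s'. ?F s' \<and> s' ''cnt'' 0 = rank ?C k \<and>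
    (\<forall>i. i \<noteq> f \<longrightarrow> s' ''y'' i = s ''y'' i) \<and> s' ''y'' f < n \<and>
    (\<forall>v<k. ?C v \<and> rank ?C v = s ''g'' f \<longrightarrow> s' ''y'' f = v)"
  have l: "1 \<le> l * l * n" using e by simp
  let ?s = "store s ''cnt'' 0 0"
  have "wp B (For ''v'' (Const 0) (Var ''n'') pick_com) ?s
    (\<lambda>t s'. t \<le> 2 + cost (Const 0) + (n - 0 + 1) * (1100 * (l * l) + cost (Var ''n'') + 10) \<and>
      ?I n s' \<and> s' ''v'' 0 = n)"
  proof (rule wp_For[where I = ?I])
    show "?I 0 (store ?s ''v'' 0 0)" using y by (simp add: store_def frame_def rank_0)
    show "fits B s' (Var ''n'') \<and> val s' (Var ''n'') = n" if "?I k s'" for k s'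
      using that e(1,10) by (simp add: frame_def)
    fix k s' assume k: "k < n" and I: "?I k s'" and v: "s' ''v'' 0 = k"
    from I have eq: "s' ''x'' = s ''x''" "s' ''g'' = s ''g''" "s' ''f'' = s ''f''"
      by (simp_all add: frame_def)
    have env': "env B n l E s'" by (rule env_frame[OF env, of "{''ok'', ''w'', ''cnt'', ''y'', ''v''}"]) (use I in auto)
    have C: "s' ''cnt'' 0 = rank (cand E l (s' ''x'') (s' ''g'') f) (s' ''v'' 0)"
      "s' ''v'' 0 < n" "s' ''f'' 0 = f" "s' ''y'' f < n" using I eq v k f by simp_all
    show "wp B pick_com s' (\<lambda>t s''. t \<le> 1100 * (l * l) \<and> s'' ''v'' 0 = k \<and>
      ?I (Suc k) (store s'' ''v'' 0 (Suc k)))"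
    proof (rule wp_mono[OF wp_pick[OF env' C(2) f(1) C(3,4,1)]])
      fix t s''
      assume *: "t \<le> 1100 * (l * l) \<and> frame {''ok'', ''w'', ''cnt'', ''y''} s' s'' \<and>
        s'' ''cnt'' 0 = rank (cand E l (s' ''x'') (s' ''g'') f) (Suc (s' ''v'' 0)) \<and> s'' ''y'' =
        (if cand E l (s' ''x'') (s' ''g'') f (s' ''v'' 0) \<and> s' ''cnt'' 0 = s' ''g'' f
         then (s' ''y'')(f := s' ''v'' 0) else s' ''y'')"
      then have y'': "s'' ''y'' = (if ?C k \<and> rank ?C k = s ''g'' f then (s' ''y'')(f := k) else s' ''y'')"
        using I eq v by simp
      have F: "?F (store s'' ''v'' 0 (Suc k))"
        using * I by (simp add: frame_def store_def)
      have "\<forall>v<Suc k. ?C v \<and> rank ?C v = s ''g'' f \<longrightarrow> s'' ''y'' f = v"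
      proof (intro allI impI)
        fix v assume vk: "v < Suc k" and v: "?C v \<and> rank ?C v = s ''g'' f"
        show "s'' ''y'' f = v"
        proof (cases "v = k")
          case True
          with v y'' show ?thesis by simp
        next
          case False
          with vk have "v < k" by simp
          with v rank_strict_mono[of v k ?C] have "rank ?C k \<noteq> s ''g'' f" by simp
          then have "s'' ''y'' f = s' ''y'' f" using y'' by simp
          with I v \<open>v < k\<close> show ?thesis by simp
        qed
      qed
      moreover have "\<forall>i. i \<noteq> f \<longrightarrow> s'' ''y'' i = s ''y'' i" "s'' ''y'' f < n"
        using y'' I k by simp_all
      moreover have "s'' ''v'' 0 = k" using * v by (simp add: frame_def)
      moreover have "s'' ''cnt'' 0 = rank ?C (Suc k)" using * eq v by simp
      ultimately show "t \<le> 1100 * (l * l) \<and> s'' ''v'' 0 = k \<and> ?I (Suc k) (store s'' ''v'' 0 (Suc k))"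
        using * F by (simp add: store_def)
    qed
  qed (use e(8,10) in simp_all)
  \<comment> \<open>A round costs 12 besides its body, and \<open>n + 1 \<le> 2 * n\<close>; this
    gives 2224, and the rest of 2300 absorbs the set-up.\<close>
  moreover have "4 + (n + 1) * (12 + 1100 * (l * l)) + 2 \<le> 2300 * (l * l * n)"
  proof -
    have "1 \<le> l * l" using e by simp
    then have "1100 * (l * l) + 12 \<le> 1112 * (l * l)" by linarith
    then have "(n + 1) * (12 + 1100 * (l * l)) \<le> (2 * n) * (1112 * (l * l))"
      using e(3) by (intro mult_le_mono) simp_all
    also have "\<dots> = 2224 * (l * l * n)" by (simp add: algebra_simps)
    finally show ?thesis using l by linarith
  qed
  ultimately show ?thesis
    unfolding wp_Seq wp_Assign by (auto elim!: wp_mono)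
qed

text \<open>\<open>cand\<close> does not read \<open>y\<close>, so filling one label does not
  disturb the candidates for another.\<close>

lemma wp_fill:
  assumes env: "env B n l E s" and y: "\<forall>i. s ''y'' i < n" "\<forall>i<2 * l. s ''y'' i = s ''x'' i"
  shows "wp B fill_com s (\<lambda>t s'. t \<le> 5000 * (l * l * l * n) \<and>
    frame {''ok'', ''w'', ''cnt'', ''y'', ''v'', ''f''} s s' \<and> (\<forall>i. s' ''y'' i < n) \<and>
    filled E n l (s ''x'') (s ''g'') (s' ''y''))"
proof -
  note e = envD[OF env]
  let ?F = "frame {''ok'', ''w'', ''cnt'', ''y'', ''v'', ''f''} s"
  let ?C = "cand E l (s ''x'') (s ''g'')"
  let ?I = "\<lambda>k s'. ?F s' \<and> (\<forall>i. s' ''y'' i < n) \<and> (\<forall>i<2 * l. s' ''y'' i = s ''x'' i) \<and>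
    (\<forall>f v. 2 * l \<le> f \<and> f < k \<and> v < n \<and> ?C f v \<and> rank (?C f) v = s ''g'' f \<longrightarrow> s' ''y'' f = v)"
  have l: "1 \<le> l * l * l * n" using e by simp
  have W: "wp B fill_com s
    (\<lambda>t s'. t \<le> 2 + cost (Bin Mul (Const 2) (Var ''l'')) +
       (3 * l - 2 * l + 1) * (2300 * (l * l * n) + cost (Bin Mul (Const 3) (Var ''l'')) + 10) \<and>
      ?I (3 * l) s' \<and> s' ''f'' 0 = 3 * l)"
    unfolding fill_com_def
  proof (rule wp_For[where I = ?I])
    show "?I (2 * l) (store s ''f'' 0 (2 * l))" using y by (auto simp: store_def frame_def)
    show "fits B s' (Bin Mul (Const 3) (Var ''l'')) \<and> val s' (Bin Mul (Const 3) (Var ''l'')) = 3 * l"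
      if "?I k s'" for k s'
      using that e(2,7,8) by (simp add: frame_def)
    fix k s' assume k: "2 * l \<le> k" "k < 3 * l" and I: "?I k s'" and f: "s' ''f'' 0 = k"
    from I have eq: "s' ''x'' = s ''x''" "s' ''g'' = s ''g''" by (simp_all add: frame_def)
    have env': "env B n l E s'"
      by (rule env_frame[OF env, of "{''ok'', ''w'', ''cnt'', ''y'', ''v'', ''f''}"]) (use I in auto)
    have y': "\<forall>i. s' ''y'' i < n" using I by simp
    show "wp B (Seq (Assign ''cnt'' (Const 0) (Const 0)) (For ''v'' (Const 0) (Var ''n'') pick_com)) s'
      (\<lambda>t s''. t \<le> 2300 * (l * l * n) \<and> s'' ''f'' 0 = k \<and> ?I (Suc k) (store s'' ''f'' 0 (Suc k)))"
    proof (rule wp_mono[OF wp_fill_one[OF env' k(2) f y']], unfold eq, elim conjE, intro conjI)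
      fix t s''
      assume fr: "frame {''ok'', ''w'', ''cnt'', ''y'', ''v''} s' s''"
        and y1: "\<forall>i. i \<noteq> k \<longrightarrow> s'' ''y'' i = s' ''y'' i" and y2: "s'' ''y'' k < n"
        and y3: "\<forall>v<n. ?C k v \<and> rank (?C k) v = s ''g'' k \<longrightarrow> s'' ''y'' k = v"
      have st: "store s'' ''f'' 0 (Suc k) ''y'' = s'' ''y''" by (simp add: store_def)
      show "s'' ''f'' 0 = k" using fr f by (simp add: frame_def)
      show "?F (store s'' ''f'' 0 (Suc k))"
        using fr I by (simp add: frame_def store_def)
      show "\<forall>i. store s'' ''f'' 0 (Suc k) ''y'' i < n"
        unfolding st using y1 y2 y' by metis
      show "\<forall>i<2 * l. store s'' ''f'' 0 (Suc k) ''y'' i = s ''x'' i"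
        unfolding st using y1 k(1) I by simp
      show "\<forall>f v. 2 * l \<le> f \<and> f < Suc k \<and> v < n \<and> ?C f v \<and> rank (?C f) v = s ''g'' f \<longrightarrow>
        store s'' ''f'' 0 (Suc k) ''y'' f = v"
        unfolding st
      proof (intro allI impI)
        fix f v assume fv: "2 * l \<le> f \<and> f < Suc k \<and> v < n \<and> ?C f v \<and> rank (?C f) v = s ''g'' f"
        show "s'' ''y'' f = v"
        proof (cases "f = k")
          case True
          with fv y3 show ?thesis by simp
        next
          case False
          with fv I y1 show ?thesis by simp
        qed
      qed
    qed
  qed (use e(2,7,8) in simp_all)
  have T: "2 + cost (Bin Mul (Const 2) (Var ''l'')) +
       (3 * l - 2 * l + 1) * (2300 * (l * l * n) + cost (Bin Mul (Const 3) (Var ''l'')) + 10)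
     \<le> 5000 * (l * l * l * n)"
  proof -
    have "1 \<le> l * l * n" using e by simp
    then have "2300 * (l * l * n) + 14 \<le> 2314 * (l * l * n)" by linarith
    then have "(3 * l - 2 * l + 1) * (14 + 2300 * (l * l * n)) \<le> (2 * l) * (2314 * (l * l * n))"
      using e(4) by (intro mult_le_mono) simp_all
    also have "\<dots> = 4628 * (l * l * l * n)" by (simp add: algebra_simps)
    finally have "6 + (3 * l - 2 * l + 1) * (14 + 2300 * (l * l * n)) \<le> 5000 * (l * l * l * n)"
      using l by linarith
    then show ?thesis by simp
  qed
  have fl: "filled E n l (s ''x'') (s ''g'') (s' ''y'')" if "?I (3 * l) s'" for s'
    using that unfolding filled_def rank_def by blast
  show ?thesis
  proof (rule wp_mono[OF W])
    fix t s'
    assume *: "t \<le> 2 + cost (Bin Mul (Const 2) (Var ''l'')) +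
       (3 * l - 2 * l + 1) * (2300 * (l * l * n) + cost (Bin Mul (Const 3) (Var ''l'')) + 10) \<and>
      ?I (3 * l) s' \<and> s' ''f'' 0 = 3 * l"
    then have "?I (3 * l) s'" by blast
    with fl * T show "t \<le> 5000 * (l * l * l * n) \<and> ?F s' \<and> (\<forall>i. s' ''y'' i < n) \<and>
      filled E n l (s ''x'') (s ''g'') (s' ''y'')" by (meson order_trans)
  qed
qed

section \<open>Enumerating the guesses\<close>

text \<open>A guess given abstractly agrees with the array in memory only on its
  \<open>3 * l\<close> digits; this and the next two facts transfer results between the two.\<close>

lemma cand_cong:
  assumes "\<forall>i<3 * l. g i = d i" shows "cand E l x g f v = cand E l x d f v"
proof -
  have "g j = d j \<and> g (l + j) = d (l + j)" if "j < l" for j using assms that by simp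
  then show ?thesis unfolding cand_def by simp
qed

lemma filled_cong:
  assumes "\<forall>i<3 * l. g i = d i" "filled E n l x g y" shows "filled E n l x d y"
  using assms(2) cand_cong[OF assms(1)] assms(1) unfolding filled_def by auto

lemma good_cong:
  assumes "\<forall>i<3 * l. g i = d i" "good E l y d" shows "good E l y g"
proof -
  have "g j = d j \<and> g (l + j) = d (l + j)" if "j < l" for j using assms that by simp
  with assms(2) show ?thesis unfolding good_def by simp
qed

section \<open>Guesses as numbers in base \<open>3 * l\<close>\<close>

text \<open>A ghost quantity that orders the guesses and measures progress; the program never
  computes it. The least significant digit comes first, so carries move to higher positions.\<close>

fun digits_val :: "nat \<Rightarrow> (nat \<Rightarrow> nat) \<Rightarrow> nat \<Rightarrow> nat" where
  "digits_val b g 0 = 0"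
| "digits_val b g (Suc k) = digits_val b g k + g k * b ^ k"

lemma digits_val_upd_ge: "k \<le> i \<Longrightarrow> digits_val b (g(i := a)) k = digits_val b g k"
  by (induction k) auto

text \<open>The old and new contributions are added on opposite sides, which avoids truncated
  subtraction when a digit decreases.\<close>

lemma digits_val_upd:
  "i < k \<Longrightarrow> digits_val b (g(i := a)) k + g i * b ^ i = digits_val b g k + a * b ^ i"
proof (induction k)
  case (Suc k)
  show ?case
  proof (cases "i = k")
    case True
    show ?thesis
      unfolding digits_val.simps True
      by (simp only: digits_val_upd_ge[OF order_refl] fun_upd_same ac_simps)
  next
    case False
    then show ?thesis using Suc by simp
  qed
qed simp

lemma digits_val_less: "\<forall>i<k. g i < b \<Longrightarrow> digits_val b g k < b ^ k"
proof (induction k)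
  case (Suc k)
  then have "digits_val b g k + g k * b ^ k < Suc (g k) * b ^ k" by simp
  also have "\<dots> \<le> b * b ^ k" using Suc.prems by (intro mult_le_mono1) (simp add: Suc_leI)
  finally show ?case by simp
qed simp

lemma digits_val_inj:
  "\<forall>i<k. g i < b \<Longrightarrow> \<forall>i<k. d i < b \<Longrightarrow> digits_val b g k = digits_val b d k \<Longrightarrow> \<forall>i<k. g i = d i"
proof (induction k)
  case (Suc k)
  have less: "digits_val b g k < b ^ k" "digits_val b d k < b ^ k"
    using Suc.prems by (auto intro: digits_val_less)
  have div: "(a + c * m) div m = c" if "a < m" for a c m :: nat
    using that by (metis add_0_right div_less div_mult_self1 less_nat_zero_code)
  have "(digits_val b g k + g k * b ^ k) div b ^ k = g k" "(digits_val b d k + d k * b ^ k) div b ^ k = d k"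
    by (rule div, rule less)+
  with Suc.prems(3) have k: "g k = d k" by simp
  with Suc.prems(3) have "digits_val b g k = digits_val b d k" by simp
  with Suc.prems(1,2) have "\<forall>i<k. g i = d i" by (intro Suc.IH) simp_all
  with k have "\<forall>i<k. g i = d i" "g k = d k" by blast+
  then show ?case by (auto simp: less_Suc_eq)
qed simp

definition next_com :: com where
  "next_com = (let b = Bin Mul (Const 3) (Var ''l''); g = Read ''g'' (Var ''i'') in
    Seq (Assign ''i'' (Const 0) (Const 0))
   (Seq (While (Bin Mul (Bin Less (Var ''i'') b) (Bin Eq (Bin Add g (Const 1)) b))
     (Seq (Assign ''g'' (Var ''i'') (Const 0)) (Assign ''i'' (Const 0) (Bin Add (Var ''i'') (Const 1)))))
   (If (Bin Less (Var ''i'') b) (Assign ''g'' (Var ''i'') (Bin Add g (Const 1)))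
     (Assign ''done'' (Const 0) (Const 1)))))"

lemma wp_next:
  assumes env: "env B n l E s"
  defines "v \<equiv> \<lambda>s :: state. digits_val (3 * l) (s ''g'') (3 * l)"
  shows "wp B next_com s (\<lambda>t s'. t \<le> 200 * l \<and> frame {''i'', ''g'', ''done''} s s' \<and>
    (\<forall>i. s' ''g'' i < 3 * l) \<and>
    (s' ''done'' 0 = s ''done'' 0 \<and> v s' = v s + 1 \<or> s' ''done'' 0 = 1 \<and> v s + 1 = (3 * l) ^ (3 * l)))"
proof -
  note e = envD[OF env]
  define pw where "pw i = (3 * l) ^ i" for i :: nat
  have pw_Suc: "pw (Suc i) = 3 * l * pw i" for i by (simp add: pw_def)
  let ?F = "frame {''i'', ''g''} s"
  \<comment> \<open>A carry into position \<open>i\<close> is pending: the current value plus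
    \<open>(3 * l) ^ i\<close> is the intended new value.\<close>
  let ?I = "\<lambda>s'. ?F s' \<and> s' ''i'' 0 \<le> 3 * l \<and> (\<forall>i. s' ''g'' i < 3 * l) \<and>
    v s' + pw (s' ''i'' 0) = v s + 1"
  let ?b = "Bin Mul (Const 3) (Var ''l'')" and ?g = "Read ''g'' (Var ''i'')"
  \<comment> \<open>The second factor is evaluated even at \<open>i = 3 * l\<close>; the cell read
    there fits because the bound on \<open>g\<close> covers all cells.\<close>
  let ?t = "Bin Mul (Bin Less (Var ''i'') ?b) (Bin Eq (Bin Add ?g (Const 1)) ?b)"
  let ?c = "Seq (Assign ''g'' (Var ''i'') (Const 0)) (Assign ''i'' (Const 0) (Bin Add (Var ''i'') (Const 1)))"
  have fits: "fits B s' ?t" "fits B s' ?b" "val s' ?b = 3 * l" "fits B s' (Var ''i'')"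
    "fits B s' ?g" "fits B s' (Bin Add ?g (Const 1))"
    and test: "val s' ?t \<noteq> 0 \<longleftrightarrow> s' ''i'' 0 < 3 * l \<and> s' ''g'' (s' ''i'' 0) + 1 = 3 * l"
    if "?I s'" for s'
  proof -
    have l: "s' ''l'' 0 = l" using that e(2) by (simp add: frame_def)
    have g: "s' ''g'' (s' ''i'' 0) + 1 \<le> 3 * l" "s' ''i'' 0 \<le> 3 * l"
      using that by (auto simp: Suc_le_eq)
    show "fits B s' ?b" "val s' ?b = 3 * l" "fits B s' (Var ''i'')"
      "fits B s' ?g" "fits B s' (Bin Add ?g (Const 1))" "fits B s' ?t"
      using l g e(7,8) by simp_all
    show "val s' ?t \<noteq> 0 \<longleftrightarrow> s' ''i'' 0 < 3 * l \<and> s' ''g'' (s' ''i'' 0) + 1 = 3 * l"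
      using l by simp
  qed
  have W: "wp B (While ?t ?c) (store s ''i'' 0 0) (\<lambda>t s'. t \<le>
    (3 * l - (store s ''i'' 0 0) ''i'' 0 + 1) * (10 + cost ?t + 1) \<and> ?I s' \<and> val s' ?t = 0)"
  proof (rule wp_While[where I = ?I])
    show "?I (store s ''i'' 0 0)"
      using e(11) by (simp add: store_def frame_def v_def pw_def)
    show "fits B s' ?t" if "?I s'" for s' using fits(1)[OF that] .
    fix s' assume I: "?I s'" and t: "val s' ?t \<noteq> 0"
    let ?i = "s' ''i'' 0"
    from test[OF I] t have i: "?i < 3 * l" "s' ''g'' ?i + 1 = 3 * l" by simp_all
    have "digits_val (3 * l) ((s' ''g'')(?i := 0)) (3 * l) + s' ''g'' ?i * pw ?i = v s'"
      using digits_val_upd[OF i(1), of "3 * l" "s' ''g''" 0] by (simp add: v_def pw_def)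
    moreover have "s' ''g'' ?i * pw ?i + pw ?i = pw (Suc ?i)"
      using i(2) by (metis Suc_eq_plus1 add.commute mult_Suc pw_Suc)
    ultimately have "digits_val (3 * l) ((s' ''g'')(?i := 0)) (3 * l) + pw (Suc ?i) = v s + 1"
      using I by linarith
    then show "wp B ?c s' (\<lambda>t s''. t \<le> 10 \<and> ?I s'' \<and> 3 * l - s'' ''i'' 0 < 3 * l - ?i)"
      using I i e(7,8) fits(4,5)[OF I] by (simp add: wp_simps frame_def v_def)
  qed
  have "wp B (If (Bin Less (Var ''i'') ?b) (Assign ''g'' (Var ''i'') (Bin Add ?g (Const 1)))
     (Assign ''done'' (Const 0) (Const 1))) s' (\<lambda>t s'. t \<le> 30 \<and> frame {''i'', ''g'', ''done''} s s' \<and>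
    (\<forall>i. s' ''g'' i < 3 * l) \<and>
    (s' ''done'' 0 = s ''done'' 0 \<and> v s' = v s + 1 \<or> s' ''done'' 0 = 1 \<and> v s + 1 = pw (3 * l)))"
    if I: "?I s'" and t: "val s' ?t = 0" for s'
  proof (cases "s' ''i'' 0 < 3 * l")
    case True
    let ?i = "s' ''i'' 0"
    have "s' ''g'' ?i + 1 \<noteq> 3 * l" "s' ''g'' ?i < 3 * l"
      using test[OF I] t True I by blast+
    then have g: "Suc (s' ''g'' ?i) < 3 * l" by simp
    have "digits_val (3 * l) ((s' ''g'')(?i := Suc (s' ''g'' ?i))) (3 * l) = v s' + pw ?i"
      using digits_val_upd[OF True, of "3 * l" "s' ''g''" "Suc (s' ''g'' ?i)"] by (simp add: v_def pw_def)
    then have "digits_val (3 * l) ((s' ''g'')(?i := Suc (s' ''g'' ?i))) (3 * l) = v s + 1"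
      using I by simp
    then show ?thesis
      using True I g fits(2-6)[OF I] e(8) by (simp add: wp_If wp_Assign store_def frame_def v_def)
  next
    case False
    \<comment> \<open>The carry has left the last digit. As \<open>v s\<close> lies below
      \<open>(3 * l) ^ (3 * l)\<close>, the guess was the largest one.\<close>
    then have "s' ''i'' 0 = 3 * l" using I by simp
    then have "v s' + pw (3 * l) = v s + 1" using I by metis
    moreover have "v s < pw (3 * l)" unfolding v_def pw_def using e(11) by (intro digits_val_less) simp
    ultimately have "v s + 1 = pw (3 * l)" by linarith
    then show ?thesis
      using False I fits(2-6)[OF I] e(8) by (simp add: wp_If wp_Assign store_def frame_def v_def)
  qed
  note If = this
  show ?thesis
    unfolding next_com_def Let_def pw_def[symmetric] wp_Seq wp_Assign
  proof (intro conjI)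
    show "wp B (While ?t ?c) (store s ''i'' (val s (Const 0)) (val s (Const 0)))
      (\<lambda>t1 s1. wp B (If (Bin Less (Var ''i'') ?b) (Assign ''g'' (Var ''i'') (Bin Add ?g (Const 1)))
         (Assign ''done'' (Const 0) (Const 1))) s1
       (\<lambda>t2 s'. 1 + cost (Const 0) + cost (Const 0) + (t1 + t2) \<le> 200 * l \<and> frame {''i'', ''g'', ''done''} s s' \<and>
    (\<forall>i. s' ''g'' i < 3 * l) \<and>
    (s' ''done'' 0 = s ''done'' 0 \<and> v s' = v s + 1 \<or> s' ''done'' 0 = 1 \<and> v s + 1 = pw (3 * l))))"
      unfolding val.simps
    proof (rule wp_mono[OF W])
      fix t1 s1
      assume *: "t1 \<le> (3 * l - (store s ''i'' 0 0) ''i'' 0 + 1) * (10 + cost ?t + 1) \<and>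
        ?I s1 \<and> val s1 ?t = 0"
      then have t1: "t1 + 40 \<le> 200 * l" using e(4) by (simp add: store_def)
      show "wp B (If (Bin Less (Var ''i'') ?b) (Assign ''g'' (Var ''i'') (Bin Add ?g (Const 1)))
         (Assign ''done'' (Const 0) (Const 1))) s1
       (\<lambda>t2 s'. 1 + cost (Const 0) + cost (Const 0) + (t1 + t2) \<le> 200 * l \<and> frame {''i'', ''g'', ''done''} s s' \<and>
    (\<forall>i. s' ''g'' i < 3 * l) \<and>
    (s' ''done'' 0 = s ''done'' 0 \<and> v s' = v s + 1 \<or> s' ''done'' 0 = 1 \<and> v s + 1 = pw (3 * l)))"
        by (rule wp_mono[OF If]) (use * t1 in auto)
    qed
  qed simp_all
qed

section \<open>The search loop\<close>

definition step_com :: com where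
  "step_com = Seq fill_com (Seq (All_loop pairs_exp check_exp) (If (Var ''ok'')
     (Seq (Assign ''out'' (Const 0) (Const 1)) (Assign ''done'' (Const 0) (Const 1))) next_com))"

text \<open>The filling is quantified existentially because the guess alone does not determine it:
  unconstrained labels keep values from earlier rounds.\<close>

lemma wp_step:
  assumes env: "env B n l E s" and y: "\<forall>i. s ''y'' i < n" "\<forall>i<2 * l. s ''y'' i = s ''x'' i"
  defines "v \<equiv> \<lambda>s :: state. digits_val (3 * l) (s ''g'') (3 * l)"
  shows "wp B step_com s (\<lambda>t s'. t \<le> 7000 * (l * l * l * n) \<and>
    (\<forall>z. z \<notin> {''ok'', ''w'', ''cnt'', ''y'', ''v'', ''f'', ''i'', ''g'', ''done'', ''out''} \<longrightarrow> s' z = s z) \<and>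
    env B n l E s' \<and> (\<forall>i. s' ''y'' i < n) \<and> (\<forall>i<2 * l. s' ''y'' i = s ''x'' i) \<and>
    (\<exists>y. filled E n l (s ''x'') (s ''g'') y \<and>
      (if good E l y (s ''g'') then s' ''out'' 0 = 1 \<and> s' ''done'' 0 = 1
       else s' ''out'' = s ''out'' \<and>
        (s' ''done'' 0 = s ''done'' 0 \<and> v s' = v s + 1 \<or> s' ''done'' 0 = 1 \<and> v s + 1 = (3 * l) ^ (3 * l)))))"
    (is "wp B step_com s ?Q")
proof -
  note e = envD[OF env]
  have "1 \<le> l * l * n" using e by simp
  then have l: "l \<le> l * l * l * n" "1 \<le> l * l * l * n"
    using e(4) mult_le_mono2[of 1 "l * l * n" l] by (simp_all add: mult.assoc)
  have ll: "l * l \<le> l * l * l * n"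
    using e(3,4) mult_le_mono2[of 1 "l * n" "l * l"] by (simp add: mult.assoc)
  show ?thesis
    unfolding step_com_def wp_Seq[of B fill_com]
  proof (rule wp_mono[OF wp_fill[OF env y]], elim conjE)
    fix t1 s1
    assume t1: "t1 \<le> 5000 * (l * l * l * n)"
      and f1: "frame {''ok'', ''w'', ''cnt'', ''y'', ''v'', ''f''} s s1"
      and y1: "\<forall>i. s1 ''y'' i < n" and fill: "filled E n l (s ''x'') (s ''g'') (s1 ''y'')"
    have env1: "env B n l E s1" by (rule env_frame[OF env f1]) auto
    have s1: "s1 ''x'' = s ''x''" "s1 ''g'' = s ''g''" "s1 ''done'' = s ''done''" "s1 ''out'' = s ''out''"
      using f1 by (simp_all add: frame_def)
    have yx: "\<forall>i<2 * l. s1 ''y'' i = s ''x'' i" using fill unfolding filled_def by blast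
    show "wp B (Seq (All_loop pairs_exp check_exp) (If (Var ''ok'')
     (Seq (Assign ''out'' (Const 0) (Const 1)) (Assign ''done'' (Const 0) (Const 1))) next_com)) s1
       (\<lambda>t. ?Q (t1 + t))"
      unfolding wp_Seq[of B "All_loop pairs_exp check_exp"]
    proof (rule wp_mono[OF wp_check[OF env1 y1]])
      fix t2 s2
      assume 2: "t2 \<le> 1000 * (l * l) \<and> s2 = store (store s1 ''ok'' 0
        (if good E l (s1 ''y'') (s1 ''g'') then 1 else 0)) ''w'' 0 (l * l)"
      have env2: "env B n l E s2" using 2 env1 by (simp add: env_store)
      have f2: "frame {''ok'', ''w''} s1 s2" using 2 by (simp add: frame_def store_def)
      have ok: "s2 ''ok'' 0 = (if good E l (s1 ''y'') (s1 ''g'') then 1 else 0)"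
        using 2 by (simp add: store_def)
      show "wp B (If (Var ''ok'') (Seq (Assign ''out'' (Const 0) (Const 1))
         (Assign ''done'' (Const 0) (Const 1))) next_com) s2 (\<lambda>t. ?Q (t1 + (t2 + t)))"
      proof (cases "good E l (s1 ''y'') (s1 ''g'')")
        case True
        let ?s = "store (store s2 ''out'' 0 1) ''done'' 0 1"
        have "env B n l E ?s" using env2 by (simp add: env_store)
        moreover have "t1 + (t2 + 10) \<le> 7000 * (l * l * l * n)" using t1 2 l ll by linarith
        moreover have "?s z = s z" if "z \<notin> {''ok'', ''w'', ''cnt'', ''y'', ''v'', ''f'', ''i'', ''g'', ''done'', ''out''}" for z
          using f1 f2 that by (simp add: frame_def store_def)
        moreover have "?s ''y'' = s1 ''y''" "?s ''out'' 0 = 1" "?s ''done'' 0 = 1"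
          using f2 by (simp_all add: frame_def store_def)
        ultimately have Q: "?Q (t1 + (t2 + t)) ?s" if "t \<le> 10" for t
          using y1 yx fill True s1 that by (intro conjI allI impI) (simp_all, blast)
        have "wp B (If (Var ''ok'') (Seq (Assign ''out'' (Const 0) (Const 1))
           (Assign ''done'' (Const 0) (Const 1))) next_com) s2 R" if "\<And>t. t \<le> 10 \<Longrightarrow> R t ?s" for R
          using ok True e(8) by (simp add: wp_If wp_Seq wp_Assign) (rule that[simplified], simp)
        then show ?thesis by this (rule Q)
      next
        case False
        have "wp B next_com s2 (\<lambda>t. ?Q (t1 + (t2 + (1 + cost (Var ''ok'') + t))))"
        proof (rule wp_mono[OF wp_next[OF env2]], elim conjE)
          fix t3 s3
          assume t3: "t3 \<le> 200 * l" and f3: "frame {''i'', ''g'', ''done''} s2 s3"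
            and g3: "\<forall>i. s3 ''g'' i < 3 * l"
            and alt: "s3 ''done'' 0 = s2 ''done'' 0 \<and>
              digits_val (3 * l) (s3 ''g'') (3 * l) = digits_val (3 * l) (s2 ''g'') (3 * l) + 1 \<or>
              s3 ''done'' 0 = 1 \<and> digits_val (3 * l) (s2 ''g'') (3 * l) + 1 = (3 * l) ^ (3 * l)"
          have s3: "s3 ''n'' = s2 ''n''" "s3 ''l'' = s2 ''l''" "s3 ''adj'' = s2 ''adj''" "s3 ''x'' = s2 ''x''"
             "s3 ''y'' = s2 ''y''" "s3 ''out'' = s2 ''out''"
            using f3 by (simp_all add: frame_def)
          have s2: "s2 ''g'' = s ''g''" "s2 ''done'' = s ''done''" "s2 ''y'' = s1 ''y''" "s2 ''out'' = s ''out''"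
            using f2 s1 by (simp_all add: frame_def)
          have "env B n l E s3"
            using env2 g3 unfolding env_def s3 by blast
          moreover have "t1 + (t2 + (1 + cost (Var ''ok'') + t3)) \<le> 7000 * (l * l * l * n)"
          proof -
            have "cost (Var ''ok'') = 2" by simp
            with t1 t3 2 l ll show ?thesis by linarith
          qed
          moreover have "s3 z = s z" if "z \<notin> {''ok'', ''w'', ''cnt'', ''y'', ''v'', ''f'', ''i'', ''g'', ''done'', ''out''}" for z
            using f1 f2 f3 that by (simp add: frame_def)
          moreover have "\<not> good E l (s1 ''y'') (s ''g'')" using False s1 by simp
          moreover have "s3 ''y'' = s1 ''y''" "s3 ''out'' = s ''out''" using s3 s2 by simp_all
          moreover have "s3 ''done'' 0 = s ''done'' 0 \<and> v s3 = v s + 1 \<or> s3 ''done'' 0 = 1 \<and> v s + 1 = (3 * l) ^ (3 * l)"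
            using alt unfolding s2 v_def .
          ultimately show "?Q (t1 + (t2 + (1 + cost (Var ''ok'') + t3))) s3"
            using y1 yx fill by metis
        qed
        then show ?thesis
          using ok False e(8) by (simp add: wp_If)
      qed
    qed
  qed
qed

definition search_com :: com where
  "search_com = While (Bin Eq (Var ''done'') (Const 0)) step_com"

text \<open>Since the filling met in a run depends on earlier rounds, \<open>complete\<close> asks
  for a guess that succeeds with every filling.\<close>

lemma wp_search:
  assumes env: "env B n l E s" and y: "\<forall>i. s ''y'' i < n" "s ''y'' = s ''x''"
    and init: "s ''done'' 0 = 0" "s ''out'' 0 = 0" "\<forall>i. s ''g'' i = 0"
    and sound: "\<And>y g. good E l y g \<Longrightarrow> P"
    and complete: "P \<Longrightarrow> \<exists>d. (\<forall>i<3 * l. d i < 3 * l) \<and> (\<forall>y. filled E n l (s ''x'') d y \<longrightarrow> good E l y d)"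
  shows "wp B search_com s (\<lambda>t s'. t \<le> ((3 * l) ^ (3 * l) + 1) * (8000 * (l * l * l * n)) \<and>
    s' ''out'' 0 = (if P then 1 else 0))"
proof -
  note e = envD[OF env]
  let ?D = "\<lambda>d. (\<forall>i<3 * l. d i < 3 * l) \<and> (\<forall>y. filled E n l (s ''x'') d y \<longrightarrow> good E l y d)"
  define v where "v d = digits_val (3 * l) d (3 * l)" for d
  define M where "M = (3 * l) ^ (3 * l)"
  \<comment> \<open>While nothing has been accepted, no guess that must succeed lies behind the
    current one; if \<open>done\<close> is set without acceptance, no such guess exists.\<close>
  let ?I = "\<lambda>s'. env B n l E s' \<and> (\<forall>i. s' ''y'' i < n) \<and> (\<forall>i<2 * l. s' ''y'' i = s ''x'' i) \<and>
    s' ''x'' = s ''x'' \<and> s' ''done'' 0 \<le> 1 \<and>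
    (s' ''out'' 0 = 0 \<and> (\<forall>d. ?D d \<longrightarrow> s' ''done'' 0 = 0 \<and> v (s' ''g'') \<le> v d) \<or>
     s' ''out'' 0 = 1 \<and> s' ''done'' 0 = 1 \<and> P)"
  \<comment> \<open>The number of guesses left. Setting \<open>done\<close> drops it to 0, a strict
    decrease because the current guess is below \<open>M\<close>.\<close>
  let ?m = "\<lambda>s' :: state. if s' ''done'' 0 = 0 then M - v (s' ''g'') else 0"
  have v_less: "v d < M" if "\<forall>i<3 * l. d i < 3 * l" for d
    unfolding v_def M_def using that by (rule digits_val_less)
  have v0: "v (s ''g'') = 0"
  proof -
    have "digits_val (3 * l) (s ''g'') k = 0" for k using init(3) by (induction k) simp_all
    then show ?thesis by (simp add: v_def)
  qed
  have W: "wp B search_com s (\<lambda>t s'. t \<le>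
    (?m s + 1) * (7000 * (l * l * l * n) + cost (Bin Eq (Var ''done'') (Const 0)) + 1) \<and>
    ?I s' \<and> val s' (Bin Eq (Var ''done'') (Const 0)) = 0)"
    unfolding search_com_def
  proof (rule wp_While[where I = ?I])
    show "?I s" using env y init v0 by simp
    show "fits B s' (Bin Eq (Var ''done'') (Const 0))" if "?I s'" for s'
      using that e(8) by simp
    fix s' assume I: "?I s'" and b: "val s' (Bin Eq (Var ''done'') (Const 0)) \<noteq> 0"
    then have d: "s' ''done'' 0 = 0" by (simp split: if_splits)
    with I have out: "s' ''out'' 0 = 0" and le: "\<And>d. ?D d \<Longrightarrow> v (s' ''g'') \<le> v d" by auto
    have env': "env B n l E s'" and y': "\<forall>i. s' ''y'' i < n" "\<forall>i<2 * l. s' ''y'' i = s' ''x'' i"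
      and x': "s' ''x'' = s ''x''"
      using I by simp_all
    have g': "\<forall>i<3 * l. s' ''g'' i < 3 * l" using envD(11)[OF env'] by blast
    show "wp B step_com s' (\<lambda>t s''. t \<le> 7000 * (l * l * l * n) \<and> ?I s'' \<and> ?m s'' < ?m s')"
    proof (rule wp_mono[OF wp_step[OF env' y']], elim conjE exE)
      fix t s'' yy
      assume t: "t \<le> 7000 * (l * l * l * n)"
        and fr: "\<forall>z. z \<notin> {''ok'', ''w'', ''cnt'', ''y'', ''v'', ''f'', ''i'', ''g'', ''done'', ''out''} \<longrightarrow> s'' z = s' z"
        and env'': "env B n l E s''" and y'': "\<forall>i. s'' ''y'' i < n" "\<forall>i<2 * l. s'' ''y'' i = s' ''x'' i"
        and fill: "filled E n l (s' ''x'') (s' ''g'') yy"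
        and res: "if good E l yy (s' ''g'') then s'' ''out'' 0 = 1 \<and> s'' ''done'' 0 = 1
          else s'' ''out'' = s' ''out'' \<and> (s'' ''done'' 0 = s' ''done'' 0 \<and>
            digits_val (3 * l) (s'' ''g'') (3 * l) = digits_val (3 * l) (s' ''g'') (3 * l) + 1 \<or>
            s'' ''done'' 0 = 1 \<and> digits_val (3 * l) (s' ''g'') (3 * l) + 1 = (3 * l) ^ (3 * l))"
      have x'': "s'' ''x'' = s ''x''" using fr x' by simp
      have m': "?m s' = M - v (s' ''g'')" "v (s' ''g'') < M" using d v_less[OF g'] by simp_all
      show "t \<le> 7000 * (l * l * l * n) \<and> ?I s'' \<and> ?m s'' < ?m s'"
      proof (cases "good E l yy (s' ''g'')")
        case True
        then have "s'' ''out'' 0 = 1" "s'' ''done'' 0 = 1" using res by simp_all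
        then show ?thesis using t env'' y'' x' x'' m' sound[OF True] by simp
      next
        case False
        \<comment> \<open>Equal numbers have equal digits, so if the rejected guess had the number
          of a successful \<open>d\<close>, the filling of this round would have been
          accepted.\<close>
        have less: "v (s' ''g'') < v d" if D: "?D d" for d
        proof (rule ccontr)
          assume "\<not> v (s' ''g'') < v d"
          with le[OF D] have "v (s' ''g'') = v d" by simp
          then have eq: "\<forall>i<3 * l. s' ''g'' i = d i"
            unfolding v_def using D g' by (intro digits_val_inj) simp_all
          then have "good E l yy (s' ''g'')"
            using filled_cong[OF eq fill] D x' good_cong[OF eq] by simp
          with False show False by simp
        qed
        from False res have out'': "s'' ''out'' 0 = 0" using out by simp
        from False res consider "s'' ''done'' 0 = 0" "v (s'' ''g'') = v (s' ''g'') + 1"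
          | "s'' ''done'' 0 = 1" "v (s' ''g'') + 1 = M"
          unfolding v_def M_def using d by auto
        then show ?thesis
        proof cases
          case 1
          have "\<forall>d. ?D d \<longrightarrow> s'' ''done'' 0 = 0 \<and> v (s'' ''g'') \<le> v d"
            using less 1 by (simp add: Suc_le_eq)
          moreover have "?m s'' < ?m s'" using 1 m' by simp
          ultimately show ?thesis using t env'' y'' x' x'' out'' 1 by simp
        next
          case 2
          have "\<not> ?D d" for d
          proof
            assume D: "?D d"
            then have "v d < M" by (intro v_less) simp
            with less[OF D] 2 show False by simp
          qed
          moreover have "?m s'' < ?m s'" using 2 m' by simp
          ultimately show ?thesis using t env'' y'' x' x'' out'' 2 by simp
        qed
      qed
    qed
  qed
  have "1 \<le> l * l * l * n" using e by simp
  then have T: "7000 * (l * l * l * n) + 4 + 1 \<le> 8000 * (l * l * l * n)" by linarith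
  have m: "?m s = M" using init v0 by simp
  show ?thesis
  proof (rule wp_mono[OF W])
    fix t s'
    assume *: "t \<le> (?m s + 1) * (7000 * (l * l * l * n) + cost (Bin Eq (Var ''done'') (Const 0)) + 1) \<and>
      ?I s' \<and> val s' (Bin Eq (Var ''done'') (Const 0)) = 0"
    have c: "cost (Bin Eq (Var ''done'') (Const 0)) = 4" by simp
    from * have "t \<le> (M + 1) * (7000 * (l * l * l * n) + 4 + 1)" unfolding m c by blast
    also have "\<dots> \<le> (M + 1) * (8000 * (l * l * l * n))" using T by (rule mult_le_mono2)
    finally have t: "t \<le> ((3 * l) ^ (3 * l) + 1) * (8000 * (l * l * l * n))" unfolding M_def .
    from * have nz: "s' ''done'' 0 \<noteq> 0" by (simp split: if_splits)
    have "?I s'" by (rule conjunct1[OF conjunct2[OF *]])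
    then have "s' ''out'' 0 = 0 \<and> (\<forall>d. ?D d \<longrightarrow> s' ''done'' 0 = 0 \<and> v (s' ''g'') \<le> v d) \<or>
      s' ''out'' 0 = 1 \<and> s' ''done'' 0 = 1 \<and> P" by (elim conjE)
    then have "s' ''out'' 0 = (if P then 1 else 0)"
    proof
      assume no: "s' ''out'' 0 = 0 \<and> (\<forall>d. ?D d \<longrightarrow> s' ''done'' 0 = 0 \<and> v (s' ''g'') \<le> v d)"
      have "\<not> P"
      proof
        assume P
        from complete[OF this] obtain d where D: "?D d" ..
        from mp[OF spec[OF conjunct2[OF no]] D] nz show False by simp
      qed
      with no show ?thesis by simp
    qed simp
    with t show "t \<le> ((3 * l) ^ (3 * l) + 1) * (8000 * (l * l * l * n)) \<and>
      s' ''out'' 0 = (if P then 1 else 0)" by blast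
  qed
qed

section \<open>Greedy matching\<close>

text \<open>Unlike \<open>store_def\<close>, this equation keeps the state from being duplicated, so that symbolic
  execution does not blow up exponentially.\<close>

lemma store_app: "store s x i a y = (if y = x then (s y)(i := a) else s y)"
  by (simp add: store_def)

lemma wp_SeqI: "wp B c1 s (\<lambda>t1 s1. wp B c2 s1 (\<lambda>t2. Q (t1 + t2))) \<Longrightarrow> wp B (Seq c1 c2) s Q"
  by (simp add: wp_Seq)

lemma wp_AssignI: "fits B s i \<Longrightarrow> fits B s e \<Longrightarrow> val s i = j \<Longrightarrow> val s e = a \<Longrightarrow>
    Q (1 + cost i + cost e) (store s x j a) \<Longrightarrow> wp B (Assign x i e) s Q"
  by (simp add: wp_Assign)

lemma wp_IfI: "fits B s b \<Longrightarrow> (val s b \<noteq> 0 \<Longrightarrow> wp B c1 s (\<lambda>t. Q (1 + cost b + t))) \<Longrightarrow>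
    (val s b = 0 \<Longrightarrow> wp B c2 s (\<lambda>t. Q (1 + cost b + t))) \<Longrightarrow> wp B (If b c1 c2) s Q"
  by (simp add: wp_If)

text \<open>Matched vertices are copied to \<open>y\<close> at once, so cover labels need no later
  initialisation. Edges at marked vertices are still entered into \<open>adj\<close>. The counters
  \<open>c\<close> and \<open>i\<close> advance last because the other assignments refer to
  them.\<close>

definition scan_step :: com where
  "scan_step = (let p = Read ''src'' (Var ''i''); q = Read ''dst'' (Var ''i''); one = Const 1;
     zero = Const 0; c1 = Bin Add (Var ''c'') one in
    Seq (Assign ''adj'' (Bin Add (Bin Mul p (Var ''n'')) q) one)
   (Seq (Assign ''adj'' (Bin Add (Bin Mul q (Var ''n'')) p) one)
   (Seq (If (Bin Eq (Bin Add (Read ''mk'' p) (Read ''mk'' q)) zero)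
      (Seq (Assign ''mk'' p one) (Seq (Assign ''mk'' q one)
      (Seq (Assign ''x'' (Var ''c'') p) (Seq (Assign ''x'' c1 q)
      (Seq (Assign ''y'' (Var ''c'') p) (Seq (Assign ''y'' c1 q)
        (Assign ''c'' zero (Bin Add (Var ''c'') (Const 2)))))))))
      Skip)
     (Assign ''i'' zero (Bin Add (Var ''i'') one)))))"

lemma wp_scan_step:
  assumes n: "s ''n'' 0 = n" "n * n \<le> B" "3 \<le> B" and i: "s ''i'' 0 = i" "Suc i \<le> B"
    and p: "s ''src'' i = p" "p < n" and q: "s ''dst'' i = q" "q < n" and pq: "p \<noteq> q"
    and mk: "s ''mk'' p \<le> 1" "s ''mk'' q \<le> 1" and c: "s ''c'' 0 + 2 \<le> B"
  shows "wp B scan_step s (\<lambda>t s'. t \<le> 200 \<and> frame {''adj'', ''mk'', ''x'', ''y'', ''c'', ''i''} s s' \<and>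
    s' ''adj'' = (s ''adj'')(p * n + q := 1, q * n + p := 1) \<and> s' ''i'' 0 = Suc i \<and>
    (if s ''mk'' p + s ''mk'' q = 0 then
       s' ''mk'' = (s ''mk'')(p := 1, q := 1) \<and> s' ''c'' 0 = s ''c'' 0 + 2 \<and>
       s' ''x'' = (s ''x'')(s ''c'' 0 := p, Suc (s ''c'' 0) := q) \<and>
       s' ''y'' = (s ''y'')(s ''c'' 0 := p, Suc (s ''c'' 0) := q)
     else s' ''mk'' = s ''mk'' \<and> s' ''c'' = s ''c'' \<and> s' ''x'' = s ''x'' \<and> s' ''y'' = s ''y''))"
proof -
  have "n \<le> n * n" by simp
  then have B: "p \<le> B" "q \<le> B" "n \<le> B" "i \<le> B" "1 \<le> B" "2 \<le> B" "s ''c'' 0 \<le> B" "Suc (s ''c'' 0) \<le> B"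
    using assms by linarith+
  have "p * n + q \<le> B" "q * n + p \<le> B"
    using mult_add_less[OF p(2) q(2)] mult_add_less[OF q(2) p(2)] n(2) by linarith+
  moreover from this have "p * n \<le> B" "q * n \<le> B" by linarith+
  ultimately have idx: "p * n + q \<le> B" "q * n + p \<le> B" "p * n \<le> B" "q * n \<le> B" by blast+
  note f = n(1) i(1) p(1) q(1) c mk[THEN order_trans, OF \<open>1 \<le> B\<close>] pq pq[symmetric] B idx i(2) store_app
  have B': "Suc 0 \<le> B" "Suc (Suc (s ''c'' 0)) \<le> B" using B c by simp_all
  have mk2: "s ''mk'' p + s ''mk'' q \<le> B" using mk B by linarith
  show ?thesis
    unfolding scan_step_def Let_def
    apply (rule wp_SeqI, rule wp_AssignI, (simp add: f B'; fail), (simp add: f B'; fail), (simp add: f B'), (simp add: f B'))+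
    apply (rule wp_SeqI, rule wp_IfI, (simp add: f B' mk2; fail))
    subgoal
      apply (rule wp_SeqI, rule wp_AssignI, (simp add: f B'; fail), (simp add: f B'; fail), (simp add: f B'), (simp add: f B'))+
      apply (rule wp_AssignI, (simp add: f B'; fail), (simp add: f B'; fail), (simp add: f B'), (simp add: f B'))+
      apply (simp add: f B' frame_def split: if_splits)
      done
    subgoal
      unfolding wp_Skip
      apply (rule wp_AssignI, (simp add: f B'; fail), (simp add: f B'; fail), (simp add: f B'), (simp add: f B'))
      apply (simp add: f B' frame_def split: if_splits)
      done
    done
qed

section \<open>Matchings and the scan invariant\<close>

definition edge_of :: "(nat \<times> nat) list \<Rightarrow> nat \<Rightarrow> nat set" where
  "edge_of es j = {fst (es ! j), snd (es ! j)}"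

definition matching :: "nat set set \<Rightarrow> nat set set \<Rightarrow> bool" where
  "matching E M \<longleftrightarrow> M \<subseteq> E \<and> (\<forall>e\<in>M. \<forall>f\<in>M. e \<noteq> f \<longrightarrow> e \<inter> f = {})"

text \<open>Two edges of a matching that share \<open>v\<close> coincide, so there is no path of two
  distinct strong edges to close.\<close>

lemma matching_imp_stc_set:
  assumes "matching E M" shows "stc_set E M"
proof -
  have eq: "u = w" if "{u, v} \<in> M" "{v, w} \<in> M" for u v w
  proof (rule ccontr)
    assume "u \<noteq> w"
    then have "{u, v} \<noteq> {v, w}" by (auto simp: doubleton_eq_iff)
    with assms that have "{u, v} \<inter> {v, w} = {}" unfolding matching_def by simp
    then show False by simp
  qed
  from assms have "M \<subseteq> E" by (simp add: matching_def)
  then show ?thesis unfolding stc_set_def by (intro conjI allI impI) (use eq in simp_all)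
qed

text \<open>The clauses on \<open>adj\<close> and on covering concern the edges read so far; a
  complete scan turns them into adjacency in \<open>E\<close> and a vertex cover. The matching is
  existential, as the program records only its end points.\<close>

definition scanned :: "nat \<Rightarrow> nat \<Rightarrow> nat set set \<Rightarrow> (nat \<times> nat) list \<Rightarrow> state \<Rightarrow> bool" where
  "scanned n l E es s \<longleftrightarrow> s ''i'' 0 \<le> length es \<and> s ''c'' 0 \<le> 2 * l \<and>
     (\<forall>u<n. \<forall>v<n. s ''adj'' (u * n + v) = (if \<exists>j<s ''i'' 0. {u, v} = edge_of es j then 1 else 0)) \<and>
     (\<forall>u. s ''mk'' u = (if u \<in> s ''x'' ` {..<s ''c'' 0} then 1 else 0)) \<and>
     (\<forall>j. s ''x'' j < n) \<and> s ''y'' = s ''x'' \<and>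
     (\<forall>j<s ''i'' 0. edge_of es j \<inter> s ''x'' ` {..<s ''c'' 0} \<noteq> {}) \<and>
     (\<exists>M. matching E M \<and> 2 * card M = s ''c'' 0 \<and> \<Union>M = s ''x'' ` {..<s ''c'' 0})"

lemma scannedD:
  assumes "scanned n l E es s"
  shows "s ''i'' 0 \<le> length es" "s ''c'' 0 \<le> 2 * l"
     "\<forall>u<n. \<forall>v<n. s ''adj'' (u * n + v) = (if \<exists>j<s ''i'' 0. {u, v} = edge_of es j then 1 else 0)"
     "\<forall>u. s ''mk'' u = (if u \<in> s ''x'' ` {..<s ''c'' 0} then 1 else 0)"
     "\<forall>j. s ''x'' j < n" "s ''y'' = s ''x''"
     "\<forall>j<s ''i'' 0. edge_of es j \<inter> s ''x'' ` {..<s ''c'' 0} \<noteq> {}"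
     "\<exists>M. matching E M \<and> 2 * card M = s ''c'' 0 \<and> \<Union>M = s ''x'' ` {..<s ''c'' 0}"
  using assms unfolding scanned_def by - (elim conjE, assumption)+

lemma mult_add_inj:
  fixes u v p q n :: nat
  assumes "u * n + v = p * n + q" "v < n" "q < n" shows "u = p \<and> v = q"
proof -
  have "(v + u * n) div n = (q + p * n) div n" "(v + u * n) mod n = (q + p * n) mod n"
    using assms(1) by (simp_all add: add.commute)
  with assms(2,3) show ?thesis by simp
qed

lemma scanned_step:
  assumes G: "ugraph {..<n} E" and S: "scanned n l E es s" and i: "s ''i'' 0 = i" "i < length es"
    and es: "edge_of es i \<in> E" "p = fst (es ! i)" "q = snd (es ! i)" "p < n" "q < n" "p \<noteq> q"
    and c: "s ''c'' 0 < 2 * l"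
    and adj: "s' ''adj'' = (s ''adj'')(p * n + q := 1, q * n + p := 1)" and i': "s' ''i'' 0 = Suc i"
    and upd: "if s ''mk'' p + s ''mk'' q = 0 then
       s' ''mk'' = (s ''mk'')(p := 1, q := 1) \<and> s' ''c'' 0 = s ''c'' 0 + 2 \<and>
       s' ''x'' = (s ''x'')(s ''c'' 0 := p, Suc (s ''c'' 0) := q) \<and>
       s' ''y'' = (s ''y'')(s ''c'' 0 := p, Suc (s ''c'' 0) := q)
     else s' ''mk'' = s ''mk'' \<and> s' ''c'' = s ''c'' \<and> s' ''x'' = s ''x'' \<and> s' ''y'' = s ''y''"
  shows "scanned n l E es s'"
proof -
  let ?c = "s ''c'' 0" and ?X = "s ''x'' ` {..<s ''c'' 0}" and ?X' = "s' ''x'' ` {..<s' ''c'' 0}"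
  have e: "edge_of es i = {p, q}" using es by (simp add: edge_of_def)
  obtain M where M: "matching E M" "2 * card M = ?c" "\<Union>M = ?X"
    using scannedD(8)[OF S] by blast
  have mk: "s ''mk'' u = (if u \<in> ?X then 1 else 0)" for u
    using scannedD(4)[OF S] by (rule spec)
  have cover: "edge_of es j \<inter> ?X \<noteq> {}" if "j < i" for j
    using scannedD(7)[OF S] i(1) that by simp
  have x: "s ''x'' j < n" for j using scannedD(5)[OF S] by simp
  have yx: "s ''y'' = s ''x''" using scannedD(6)[OF S] .
  have adj0: "s ''adj'' (u * n + v) = (if \<exists>j<i. {u, v} = edge_of es j then 1 else 0)" if "u < n" "v < n" for u v
    using scannedD(3)[OF S] i(1) that by simp
  have "s' ''adj'' (u * n + v) = (if \<exists>j<Suc i. {u, v} = edge_of es j then 1 else 0)" if "u < n" "v < n" for u v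
  proof -
    have idx: "u * n + v = p * n + q \<longleftrightarrow> u = p \<and> v = q" "u * n + v = q * n + p \<longleftrightarrow> u = q \<and> v = p"
      using mult_add_inj that es by blast+
    have if_if: "(if C' then a else if C then a else b) = (if C \<or> C' then a else b)" for C C' and a b :: nat
      by simp
    have "s' ''adj'' (u * n + v) = (if {u, v} = {p, q} then 1 else s ''adj'' (u * n + v))"
      unfolding adj fun_upd_apply idx doubleton_eq_iff by (rule if_if)
    moreover have "(\<exists>j<Suc i. {u, v} = edge_of es j) \<longleftrightarrow> {u, v} = {p, q} \<or> (\<exists>j<i. {u, v} = edge_of es j)"
      using e by (metis less_Suc_eq)
    ultimately show ?thesis using adj0[OF that] by simp
  qed
  then have 1: "\<forall>u<n. \<forall>v<n. s' ''adj'' (u * n + v) = (if \<exists>j<s' ''i'' 0. {u, v} = edge_of es j then 1 else 0)"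
    using i' by simp
  have 2: "\<forall>j. s' ''x'' j < n" "s' ''y'' = s' ''x''"
    using upd x yx es by (simp_all split: if_splits)
  show ?thesis
  proof (cases "p \<in> ?X \<or> q \<in> ?X")
    case True
    then have "s ''mk'' p + s ''mk'' q \<noteq> 0" by (auto simp: mk)
    with upd have u: "s' ''mk'' = s ''mk''" "s' ''c'' = s ''c''" "s' ''x'' = s ''x''" by simp_all
    have "\<forall>j<s' ''i'' 0. edge_of es j \<inter> ?X' \<noteq> {}"
      using cover True e u i' by (auto simp: less_Suc_eq)
    moreover have "\<forall>u. s' ''mk'' u = (if u \<in> ?X' then 1 else 0)" using mk u by simp
    moreover have "\<exists>M. matching E M \<and> 2 * card M = s' ''c'' 0 \<and> \<Union>M = ?X'" using M u by auto
    moreover have "s' ''i'' 0 \<le> length es" "s' ''c'' 0 \<le> 2 * l" using i' i c u by simp_all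
    ultimately show ?thesis unfolding scanned_def using 1 2 by - (intro conjI; assumption)
  next
    case False
    then have "s ''mk'' p + s ''mk'' q = 0" by (simp add: mk)
    with upd have u: "s' ''mk'' = (s ''mk'')(p := 1, q := 1)" "s' ''c'' 0 = ?c + 2"
       "s' ''x'' = (s ''x'')(?c := p, Suc ?c := q)" by simp_all
    have "{..<?c + 2} = insert (Suc ?c) (insert ?c {..<?c})" by auto
    then have X': "?X' = insert q (insert p ?X)"
      unfolding u by (auto simp: image_iff)
    have "\<forall>j<s' ''i'' 0. edge_of es j \<inter> ?X' \<noteq> {}"
      using cover e i' unfolding X' by (auto simp: less_Suc_eq)
    moreover have "\<forall>v. s' ''mk'' v = (if v \<in> ?X' then 1 else 0)" using mk u(1) unfolding X' by simp
    moreover have "\<exists>M. matching E M \<and> 2 * card M = s' ''c'' 0 \<and> \<Union>M = ?X'"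
    proof (intro exI conjI)
      have nin: "{p, q} \<notin> M" using M(3) False by auto
      have fin: "finite M" using M(1) finite_subset[OF _ ugraph_finite[OF G]] unfolding matching_def by blast
      have disj: "f \<inter> {p, q} = {}" if "f \<in> M" for f using that M(3) False by blast
      show "matching E (insert {p, q} M)"
        using M(1) es(1) e disj unfolding matching_def by (auto simp: Int_commute)
      show "2 * card (insert {p, q} M) = s' ''c'' 0" using nin fin M(2) u by simp
      show "\<Union>(insert {p, q} M) = ?X'" using M(3) unfolding X' by auto
    qed
    moreover have "s' ''i'' 0 \<le> length es" using i' i by simp
    \<comment> \<open>\<open>c\<close> is even, so \<open>c < 2 * l\<close> leaves room for two more
      vertices.\<close>
    moreover have "s' ''c'' 0 \<le> 2 * l"
    proof -
      have "2 * card M < 2 * l" using M(2) c by simp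
      then have "2 * card M + 2 \<le> 2 * l" by presburger
      then show ?thesis using u M(2) by simp
    qed
    ultimately show ?thesis unfolding scanned_def using 1 2 by - (intro conjI; assumption)
  qed
qed

section \<open>The number of edges read\<close>

lemma edge_of_nth: "j < length es \<Longrightarrow> edge_of es j = map (\<lambda>(u, v). {u, v}) es ! j"
  by (simp add: edge_of_def case_prod_beta)

lemma edge_of_image:
  assumes "edge_list E es" shows "edge_of es ` {..<length es} = E"
proof -
  have nth_image: "(!) xs ` {..<length xs} = set xs" for xs :: "nat set list"
    by (auto simp: set_conv_nth)
  have "edge_of es ` {..<length es} = (\<lambda>j. map (\<lambda>(u, v). {u, v}) es ! j) ` {..<length es}"
    by (intro image_cong refl edge_of_nth) simp
  also have "\<dots> = set (map (\<lambda>(u, v). {u, v}) es)"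
    using nth_image[of "map (\<lambda>(u, v). {u, v}) es"] by simp
  finally show ?thesis using assms unfolding edge_list_def by simp
qed

lemma edge_of_inj:
  assumes "edge_list E es" shows "inj_on (edge_of es) {..<length es}"
proof (rule inj_onI)
  fix i j assume ij: "i \<in> {..<length es}" "j \<in> {..<length es}" "edge_of es i = edge_of es j"
  then have "map (\<lambda>(u, v). {u, v}) es ! i = map (\<lambda>(u, v). {u, v}) es ! j"
    using edge_of_nth by auto
  with ij assms nth_eq_iff_index_eq[of "map (\<lambda>(u, v). {u, v}) es" i j] show "i = j"
    unfolding edge_list_def by simp
qed

lemma edge_of_facts:
  assumes "ugraph {..<n} E" "edge_list E es" "j < length es"
  shows "edge_of es j \<in> E" "fst (es ! j) < n" "snd (es ! j) < n" "fst (es ! j) \<noteq> snd (es ! j)"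
proof -
  show E: "edge_of es j \<in> E" using edge_of_image[OF assms(2)] assms(3) by blast
  then have "edge_of es j \<subseteq> {..<n}" using assms(1) unfolding ugraph_def by simp
  then show "fst (es ! j) < n" "snd (es ! j) < n" by (simp_all add: edge_of_def)
  show "fst (es ! j) \<noteq> snd (es ! j)"
    using ugraph_irrefl[OF assms(1) E[unfolded edge_of_def]] .
qed

text \<open>Each edge read contains one of \<open>c\<close> vertices, and a vertex lies on at most
  \<open>n\<close> edges, each listed once. With the identity as \<open>x\<close> the same count
  bounds the whole list.\<close>

lemma covered_prefix_bound:
  assumes G: "ugraph {..<n} E" "edge_list E es" and i: "i \<le> length es"
    and cover: "\<forall>j<i. edge_of es j \<inter> x ` {..<c} \<noteq> {}"
  shows "i \<le> c * n"
proof -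
  let ?S = "(\<lambda>(k, v). {x k, v}) ` ({..<c} \<times> {..<n})"
  have "edge_of es ` {..<i} \<subseteq> ?S"
  proof
    fix e assume "e \<in> edge_of es ` {..<i}"
    then obtain j where j: "e = edge_of es j" "j < i" by auto
    then obtain k where k: "k < c" "x k \<in> e" using cover by blast
    have "e \<in> E" using edge_of_facts(1)[OF G] j i by simp
    then obtain v where "e = {x k, v}" "v < n" using ugraph_edgeE[OF G(1) _ k(2)] by blast
    with k show "e \<in> ?S" by force
  qed
  then have "card (edge_of es ` {..<i}) \<le> card ?S" by (intro card_mono) simp_all
  also have "\<dots> \<le> c * n" using card_image_le[of "{..<c} \<times> {..<n}"] by (simp add: card_cartesian_product)
  finally show ?thesis
    using card_image[OF inj_on_subset[OF edge_of_inj[OF G(2)]], of "{..<i}"] i by simp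
qed

definition scan_com :: com where
  "scan_com = While (Bin Mul (Bin Less (Var ''i'') (Var ''m'')) (Bin Less (Var ''c'') (Bin Mul (Const 2) (Var ''l''))))
     scan_step"

text \<open>\<open>zero\<close> is what permits linear time: the matrix of \<open>n * n\<close>
  cells is empty at the start and need not be cleared.\<close>

lemma wp_scan:
  assumes G: "ugraph {..<n} E" "edge_list E es"
    and s: "s ''n'' 0 = n" "s ''l'' 0 = l" "s ''m'' 0 = length es"
      "\<And>j. j < length es \<Longrightarrow> s ''src'' j = fst (es ! j)" "\<And>j. j < length es \<Longrightarrow> s ''dst'' j = snd (es ! j)"
    and zero: "\<And>y j. y \<in> {''adj'', ''mk'', ''x'', ''y''} \<Longrightarrow> s y j = 0" "s ''c'' 0 = 0" "s ''i'' 0 = 0"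
    and B: "n * n \<le> B" "3 * l \<le> B" "3 \<le> B" "length es \<le> B" and l: "1 \<le> l" "1 \<le> n"
  shows "wp B scan_com s (\<lambda>t s'. t \<le> 1000 * (l * n) \<and> frame {''adj'', ''mk'', ''x'', ''y'', ''c'', ''i''} s s' \<and>
    scanned n l E es s' \<and> (s' ''i'' 0 = length es \<or> s' ''c'' 0 = 2 * l))"
proof -
  let ?t = "Bin Mul (Bin Less (Var ''i'') (Var ''m'')) (Bin Less (Var ''c'') (Bin Mul (Const 2) (Var ''l'')))"
  let ?I = "\<lambda>s'. frame {''adj'', ''mk'', ''x'', ''y'', ''c'', ''i''} s s' \<and> scanned n l E es s'"
  \<comment> \<open>The variant rests on the covering clause, which gives
    \<open>i \<le> 2 * l * n\<close>; the added 1 allows a strict decrease when \<open>i\<close>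
    equals this bound.\<close>
  have W: "wp B scan_com s (\<lambda>t s'. t \<le> ((2 * l * n + 1 - s ''i'' 0) + 1) * (200 + cost ?t + 1) \<and>
     ?I s' \<and> val s' ?t = 0)"
    unfolding scan_com_def
  proof (rule wp_While[where I = ?I and m = "\<lambda>s'. 2 * l * n + 1 - s' ''i'' 0"])
    have "matching E {}" by (simp add: matching_def)
    then have "\<exists>M. matching E M \<and> 2 * card M = s ''c'' 0 \<and> \<Union>M = s ''x'' ` {..<s ''c'' 0}"
      using zero(2) by (intro exI[of _ "{}"]) simp
    moreover have "s ''y'' = s ''x''" using zero(1) by (simp add: fun_eq_iff)
    ultimately show "?I s" using zero l unfolding scanned_def by (simp add: frame_def)
    fix s' assume I: "?I s'"
    then have F: "s' ''n'' 0 = n" "s' ''l'' 0 = l" "s' ''m'' 0 = length es" "s' ''src'' = s ''src''" "s' ''dst'' = s ''dst''"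
      using s by (simp_all add: frame_def)
    have ic: "s' ''i'' 0 \<le> length es" "s' ''c'' 0 \<le> 2 * l" using scannedD(1,2)[OF conjunct2[OF I]] .
    then have b: "s' ''i'' 0 \<le> B" "s' ''c'' 0 \<le> B" "2 * l \<le> B" "l \<le> B" "1 \<le> B" using B by linarith+
    show "fits B s' ?t" using F b B by simp
    assume t: "val s' ?t \<noteq> 0"
    let ?i = "s' ''i'' 0"
    from t F have i: "?i < length es" and c: "s' ''c'' 0 < 2 * l" by (auto split: if_splits)
    note ef = edge_of_facts[OF G i]
    have mk: "s' ''mk'' u \<le> 1" for u using scannedD(4)[OF conjunct2[OF I]] by simp
    have iB: "Suc ?i \<le> B" "s' ''c'' 0 + 2 \<le> B" using i c B l by linarith+
    have src: "s' ''src'' ?i = fst (es ! ?i)" "s' ''dst'' ?i = snd (es ! ?i)" using s(4,5)[OF i] F by simp_all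
    show "wp B scan_step s' (\<lambda>t s''. t \<le> 200 \<and> ?I s'' \<and> 2 * l * n + 1 - s'' ''i'' 0 < 2 * l * n + 1 - ?i)"
    proof (rule wp_mono[OF wp_scan_step[OF F(1) B(1,3) refl iB(1) src(1) ef(2) src(2) ef(3,4) mk mk iB(2)]], elim conjE)
      fix t s''
      assume t: "t \<le> 200" and fr: "frame {''adj'', ''mk'', ''x'', ''y'', ''c'', ''i''} s' s''"
       and adj: "s'' ''adj'' = (s' ''adj'')(fst (es ! ?i) * n + snd (es ! ?i) := 1, snd (es ! ?i) * n + fst (es ! ?i) := 1)"
       and i'': "s'' ''i'' 0 = Suc ?i"
       and upd: "if s' ''mk'' (fst (es ! ?i)) + s' ''mk'' (snd (es ! ?i)) = 0 then
         s'' ''mk'' = (s' ''mk'')(fst (es ! ?i) := 1, snd (es ! ?i) := 1) \<and> s'' ''c'' 0 = s' ''c'' 0 + 2 \<and>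
         s'' ''x'' = (s' ''x'')(s' ''c'' 0 := fst (es ! ?i), Suc (s' ''c'' 0) := snd (es ! ?i)) \<and>
         s'' ''y'' = (s' ''y'')(s' ''c'' 0 := fst (es ! ?i), Suc (s' ''c'' 0) := snd (es ! ?i))
         else s'' ''mk'' = s' ''mk'' \<and> s'' ''c'' = s' ''c'' \<and> s'' ''x'' = s' ''x'' \<and> s'' ''y'' = s' ''y''"
      have "scanned n l E es s''"
        using scanned_step[OF G(1) conjunct2[OF I] refl i ef(1) refl refl ef(2-4) c adj i'' upd] .
      moreover have "frame {''adj'', ''mk'', ''x'', ''y'', ''c'', ''i''} s s''"
        using fr I by (simp add: frame_def)
      moreover have "?i \<le> s' ''c'' 0 * n"
        using covered_prefix_bound[OF G ic(1) scannedD(7)[OF conjunct2[OF I]]] .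
      then have "?i \<le> 2 * l * n" using mult_le_mono1[OF ic(2), of n] by linarith
      ultimately show "t \<le> 200 \<and> ?I s'' \<and> 2 * l * n + 1 - s'' ''i'' 0 < 2 * l * n + 1 - ?i"
        using t i'' by simp
    qed
  qed
  have "1 \<le> l * n" using l by simp
  moreover have "(2 * K + 1 - 0 + 1) * (200 + 13 + 1) \<le> 1000 * K" if "1 \<le> K" for K :: nat
    using that by simp
  ultimately have "(2 * (l * n) + 1 - 0 + 1) * (200 + 13 + 1) \<le> 1000 * (l * n)" by blast
  moreover have "cost ?t = 13" by simp
  ultimately have T: "((2 * l * n + 1 - s ''i'' 0) + 1) * (200 + cost ?t + 1) \<le> 1000 * (l * n)"
    using zero(3) by (simp only: mult.assoc)
  show ?thesis
  proof (rule wp_mono[OF W])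
    fix t s'
    assume *: "t \<le> ((2 * l * n + 1 - s ''i'' 0) + 1) * (200 + cost ?t + 1) \<and> ?I s' \<and> val s' ?t = 0"
    have I: "?I s'" by (rule conjunct1[OF conjunct2[OF *]])
    then have F: "s' ''l'' 0 = l" "s' ''m'' 0 = length es" using s by (simp_all add: frame_def)
    have "s' ''i'' 0 \<le> length es" "s' ''c'' 0 \<le> 2 * l" using scannedD(1,2)[OF conjunct2[OF I]] .
    with * F have "s' ''i'' 0 = length es \<or> s' ''c'' 0 = 2 * l" by (auto split: if_splits)
    with * T I show "t \<le> 1000 * (l * n) \<and> frame {''adj'', ''mk'', ''x'', ''y'', ''c'', ''i''} s s' \<and>
      scanned n l E es s' \<and> (s' ''i'' 0 = length es \<or> s' ''c'' 0 = 2 * l)" by (meson order_trans)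
  qed
qed

section \<open>The complete program\<close>

definition main_com :: com where
  "main_com = Seq (Assign ''l'' (Const 0) (Bin Sub (Var ''m'') (Var ''k'')))
     (If (Var ''l'')
       (Seq scan_com (If (Bin Less (Var ''c'') (Bin Mul (Const 2) (Var ''l''))) search_com
         (Assign ''out'' (Const 0) (Const 1))))
       (Assign ''out'' (Const 0) (Const 1)))"

lemma length_edge_list:
  fixes E :: "nat set set"
  assumes "edge_list E es" shows "length es = card E"
  using card_image[OF edge_of_inj[OF assms]] edge_of_image[OF assms] by simp

lemma length_edge_list_le:
  assumes "ugraph {..<n} E" "edge_list E es" shows "length es \<le> n * n"
proof (rule covered_prefix_bound[OF assms order_refl])
  show "\<forall>j<length es. edge_of es j \<inter> (\<lambda>i. i) ` {..<n} \<noteq> {}"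
    using edge_of_facts(2)[OF assms] by (auto simp: edge_of_def)
qed

text \<open>For \<open>l \<ge> 2\<close> the inequality \<open>3 * l \<le> l ^ 3\<close> turns
  \<open>(3 * l) ^ (3 * l)\<close> into a power of \<open>l\<close>. For \<open>l = 1\<close> all
  powers of \<open>l\<close> are 1, so the factor 27 has to absorb \<open>3 ^ 3\<close>. The
  polynomial factor \<open>l ^ 3\<close> goes into the exponent by
  \<open>9 * l + 3 \<le> 19 * l\<close>.\<close>

lemma search_bound:
  fixes l n :: nat
  assumes l: "1 \<le> l" and n: "1 \<le> n"
  shows "50 + 1000 * (l * n) + ((3 * l) ^ (3 * l) + 1) * (8000 * (l * l * l * n)) \<le> 300000 * l ^ (19 * l) * n"
proof -
  have pow: "l ^ i \<le> l ^ j" if "i \<le> j" for i j using l that by (intro power_increasing) simp_all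
  have "(3 * l) ^ (3 * l) \<le> 27 * l ^ (9 * l)"
  proof (cases "l = 1")
    case False
    with l have "2 \<le> l" by simp
    then have "2 * 2 \<le> l * l" by (rule mult_le_mono) fact
    then have "3 * l \<le> (l * l) * l" by (intro mult_le_mono1) simp
    then have "3 * l \<le> l ^ 3" by (simp add: power3_eq_cube)
    then have "(3 * l) ^ (3 * l) \<le> (l ^ 3) ^ (3 * l)" by (rule power_mono) simp
    also have "\<dots> = l ^ (9 * l)" by (simp flip: power_mult)
    finally show ?thesis by simp
  qed simp
  moreover have "1 \<le> l ^ (9 * l)" using l by simp
  ultimately have "(3 * l) ^ (3 * l) + 1 \<le> 28 * l ^ (9 * l)" by linarith
  then have "((3 * l) ^ (3 * l) + 1) * (8000 * (l * l * l * n)) \<le> 28 * l ^ (9 * l) * (8000 * (l * l * l * n))"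
    by (rule mult_le_mono1)
  also have "\<dots> = 224000 * (l ^ (9 * l + 3) * n)" by (simp add: power_add power3_eq_cube)
  also have "\<dots> \<le> 224000 * (l ^ (19 * l) * n)"
    using pow[of "9 * l + 3" "19 * l"] l by (intro mult_le_mono mult_le_mono1 order_refl) simp
  finally have 1: "((3 * l) ^ (3 * l) + 1) * (8000 * (l * l * l * n)) \<le> 224000 * (l ^ (19 * l) * n)" .
  have "l * n \<le> l ^ (19 * l) * n" using pow[of 1 "19 * l"] l by (intro mult_le_mono1) simp
  moreover have "1 \<le> l * n" using l n by simp
  ultimately have "50 + 1000 * (l * n) + ((3 * l) ^ (3 * l) + 1) * (8000 * (l * l * l * n))
    \<le> 300000 * (l ^ (19 * l) * n)" using 1 by linarith
  then show ?thesis by (simp only: mult.assoc)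
qed

lemma wp_main:
  assumes G: "ugraph {..<n} E" "edge_list E es" and B: "B = (n + k + 2) ^ 10"
  defines "l \<equiv> card E - k"
  shows "wp B main_com (stc_input n es k) (\<lambda>t s. t \<le> 300000 * l ^ (19 * l) * max 1 n \<and>
    s ''out'' 0 = (if strong_triadic_closure E k then 1 else 0))"
proof -
  define s0 where "s0 = store (stc_input n es k) ''l'' 0 l"
  have stc: "strong_triadic_closure E k \<longleftrightarrow> (\<exists>S. stc_set E S \<and> card S = l)"
    unfolding l_def by (rule strong_triadic_closure_iff[OF ugraph_finite[OF G(1)]])
  \<comment> \<open>The summand 2 ensures \<open>a \<ge> 2\<close>, so fixed constants are bounded
    by powers of \<open>a\<close>. As \<open>l \<le> n * n\<close>, the fourth power of
    \<open>a\<close> suffices for \<open>l * l\<close> and \<open>3 * l\<close>.\<close>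
  define a where "a = n + k + 2"
  have a: "2 \<le> a" "n \<le> a" "k \<le> a" unfolding a_def by simp_all
  have pow: "a ^ i \<le> B" if "i \<le> 10" for i
    unfolding B a_def[symmetric] using a that by (intro power_increasing) simp_all
  have nn: "n * n \<le> a ^ 2" using a by (simp add: power2_eq_square mult_le_mono)
  have m: "length es \<le> n * n" by (rule length_edge_list_le[OF G])
  have ln: "l \<le> n * n" using m length_edge_list[OF G(2)] unfolding l_def by simp
  have four: "4 \<le> a ^ 2" using power_mono[of 2 a 2] a by simp
  have "l * l \<le> a ^ 2 * a ^ 2" using ln nn by (intro mult_le_mono) simp_all
  also have "\<dots> = a ^ 4" by (simp flip: power_add)
  finally have ll: "l * l \<le> B" using pow[of 4] by simp
  have "3 * l \<le> a ^ 2 * a ^ 2" using ln nn four by (intro mult_le_mono) simp_all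
  also have "\<dots> = a ^ 4" by (simp flip: power_add)
  finally have l3: "3 * l \<le> B" using pow[of 4] by simp
  have Bs: "n * n \<le> B" "length es \<le> B" "k \<le> B" "3 \<le> B" "l \<le> B"
    using nn m a four pow[of 1] pow[of 2] l3 by simp_all
  have init: "wp B main_com (stc_input n es k) Q"
    if "wp B (If (Var ''l'') (Seq scan_com (If (Bin Less (Var ''c'') (Bin Mul (Const 2) (Var ''l''))) search_com
         (Assign ''out'' (Const 0) (Const 1)))) (Assign ''out'' (Const 0) (Const 1))) s0 (\<lambda>t. Q (7 + t))" for Q
  proof -
    have in_vals: "stc_input n es k ''m'' 0 = length es" "stc_input n es k ''k'' 0 = k"
      by (simp_all add: stc_input_def)
    have e: "1 + cost (Const 0) + cost (Bin Sub (Var ''m'') (Var ''k'')) = 7" by simp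
    show ?thesis unfolding main_com_def
    proof (rule wp_SeqI, rule wp_AssignI)
      show "val (stc_input n es k) (Bin Sub (Var ''m'') (Var ''k'')) = l"
        using in_vals length_edge_list[OF G(2)] by (simp add: l_def)
      show "fits B (stc_input n es k) (Bin Sub (Var ''m'') (Var ''k''))"
        using in_vals Bs by simp
    qed (use that[unfolded s0_def] in \<open>simp_all only: e fits.simps val.simps le0\<close>)
  qed
  show ?thesis
  proof (cases "l = 0")
    case True
    then have "stc_set E {} \<and> card {} = l" by (simp add: stc_set_def)
    then have yes: "strong_triadic_closure E k" using stc by blast
    show ?thesis
      by (rule init, rule wp_IfI) (use True yes Bs in \<open>simp_all add: s0_def wp_Assign store_app\<close>)
  next
    case False
    then have l: "1 \<le> l" by simp
    \<comment> \<open>Without vertices there are no edges, so \<open>max 1 n\<close> differs from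
      \<open>n\<close> only when \<open>l = 0\<close>.\<close>
    with ln have n: "1 \<le> n" by (cases n) simp_all
    have s0: "s0 ''n'' 0 = n" "s0 ''l'' 0 = l" "s0 ''m'' 0 = length es"
      "\<And>j. j < length es \<Longrightarrow> s0 ''src'' j = fst (es ! j)" "\<And>j. j < length es \<Longrightarrow> s0 ''dst'' j = snd (es ! j)"
      "\<And>y j. y \<in> {''adj'', ''mk'', ''x'', ''y''} \<Longrightarrow> s0 y j = 0" "s0 ''c'' 0 = 0" "s0 ''i'' 0 = 0"
      "s0 ''done'' 0 = 0" "s0 ''out'' 0 = 0" "\<And>j. s0 ''g'' j = 0"
      by (auto simp: s0_def stc_input_def store_app)
    let ?R = "\<lambda>t s. t \<le> 300000 * l ^ (19 * l) * max 1 n \<and>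
      s ''out'' 0 = (if strong_triadic_closure E k then 1 else 0)"
    have bound: "t \<le> 300000 * l ^ (19 * l) * max 1 n"
      if "t \<le> 50 + 1000 * (l * n) + ((3 * l) ^ (3 * l) + 1) * (8000 * (l * l * l * n))" for t
      using search_bound[OF l n] that n by (simp add: max_def)
    have scan: "wp B scan_com s0 (\<lambda>t s'. t \<le> 1000 * (l * n) \<and>
      frame {''adj'', ''mk'', ''x'', ''y'', ''c'', ''i''} s0 s' \<and> scanned n l E es s' \<and>
      (s' ''i'' 0 = length es \<or> s' ''c'' 0 = 2 * l))"
      by (rule wp_scan[OF G]) (erule s0(4-6) | rule s0(1-3,7,8) Bs l3 l n)+
    have "wp B (Seq scan_com (If (Bin Less (Var ''c'') (Bin Mul (Const 2) (Var ''l''))) search_com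
         (Assign ''out'' (Const 0) (Const 1)))) s0 (\<lambda>t. ?R (7 + (3 + t)))"
    proof (rule wp_SeqI, rule wp_mono[OF scan], elim conjE)
      fix t1 s
      assume t1: "t1 \<le> 1000 * (l * n)" and fr: "frame {''adj'', ''mk'', ''x'', ''y'', ''c'', ''i''} s0 s"
        and S: "scanned n l E es s" and fin: "s ''i'' 0 = length es \<or> s ''c'' 0 = 2 * l"
      have s: "s ''n'' = s0 ''n''" "s ''l'' = s0 ''l''" "s ''g'' = s0 ''g''" "s ''done'' = s0 ''done''" "s ''out'' = s0 ''out''"
        using fr by (simp_all add: frame_def)
      have c: "s ''c'' 0 \<le> 2 * l" "s ''c'' 0 \<le> B" "2 * l \<le> B" using scannedD(2)[OF S] l3 by linarith+
      show "wp B (If (Bin Less (Var ''c'') (Bin Mul (Const 2) (Var ''l''))) search_com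
         (Assign ''out'' (Const 0) (Const 1))) s (\<lambda>t. ?R (7 + (3 + (t1 + t))))"
      proof (rule wp_IfI)
        show "fits B s (Bin Less (Var ''c'') (Bin Mul (Const 2) (Var ''l'')))"
          using c s s0 Bs by simp
        assume "val s (Bin Less (Var ''c'') (Bin Mul (Const 2) (Var ''l''))) \<noteq> 0"
        then have less: "s ''c'' 0 < 2 * l" using s s0 by (simp split: if_splits)
        \<comment> \<open>The scan stopped short of \<open>2 * l\<close> matched vertices, so it has
          read the whole list.\<close>
        with fin have i: "s ''i'' 0 = length es" by simp
        have edges: "(\<exists>j<s ''i'' 0. e = edge_of es j) \<longleftrightarrow> e \<in> E" for e
          unfolding i edge_of_image[OF G(2), symmetric] by auto
        have env: "env B n l E s"
          unfolding env_def
        proof (intro conjI)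
          show "\<forall>u<n. \<forall>v<n. s ''adj'' (u * n + v) = (if {u, v} \<in> E then 1 else 0)"
            using scannedD(3)[OF S] unfolding edges .
          show "\<forall>i. s ''x'' i < n" by (rule scannedD(5)[OF S])
          show "\<forall>i. s ''g'' i < 3 * l" using s s0 l by simp
        qed (use s s0 Bs ll l3 l n in simp_all)
        have cover: "\<exists>i<s ''c'' 0. s ''x'' i \<in> e" if e: "e \<in> E" for e
        proof -
          from e obtain j where "j < s ''i'' 0" "e = edge_of es j" using edges by blast
          with scannedD(7)[OF S] have "e \<inter> s ''x'' ` {..<s ''c'' 0} \<noteq> {}" by blast
          then show ?thesis by blast
        qed
        have "wp B search_com s (\<lambda>t s'. t \<le> ((3 * l) ^ (3 * l) + 1) * (8000 * (l * l * l * n)) \<and>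
          s' ''out'' 0 = (if strong_triadic_closure E k then 1 else 0))"
        proof (rule wp_search[OF env _ scannedD(6)[OF S]])
          show "\<forall>i. s ''y'' i < n" using scannedD(5,6)[OF S] by simp
          show "s ''done'' 0 = 0" "s ''out'' 0 = 0" "\<forall>i. s ''g'' i = 0" using s s0 by simp_all
          show "strong_triadic_closure E k" if "good E l y g" for y g
            using good_imp_stc_set[OF G(1) that] stc by blast
          assume "strong_triadic_closure E k"
          then obtain S where "stc_set E S" "card S = l" using stc by blast
          then show "\<exists>d. (\<forall>i<3 * l. d i < 3 * l) \<and> (\<forall>y. filled E n l (s ''x'') d y \<longrightarrow> good E l y d)"
            by (rule stc_set_imp_good[OF G(1) _ _ less cover])
        qed
        then show "wp B search_com s (\<lambda>t. ?R (7 + (3 + (t1 + (1 + cost (Bin Less (Var ''c'') (Bin Mul (Const 2) (Var ''l''))) + t)))))"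
        proof (rule wp_mono, elim conjE, intro conjI)
          fix t s'
          assume "t \<le> ((3 * l) ^ (3 * l) + 1) * (8000 * (l * l * l * n))"
          moreover have "cost (Bin Less (Var ''c'') (Bin Mul (Const 2) (Var ''l''))) = 7" by simp
          ultimately show "7 + (3 + (t1 + (1 + cost (Bin Less (Var ''c'') (Bin Mul (Const 2) (Var ''l''))) + t)))
            \<le> 300000 * l ^ (19 * l) * max 1 n"
            using t1 by (intro bound) linarith
        qed
      next
        assume "val s (Bin Less (Var ''c'') (Bin Mul (Const 2) (Var ''l''))) = 0"
        then have c2: "s ''c'' 0 = 2 * l" using s s0 c by (simp split: if_splits)
        obtain M where "matching E M" "2 * card M = s ''c'' 0" using scannedD(8)[OF S] by blast
        with c2 matching_imp_stc_set have "stc_set E M \<and> card M = l" by simp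
        then have yes: "strong_triadic_closure E k" using stc by blast
        show "wp B (Assign ''out'' (Const 0) (Const 1)) s
          (\<lambda>t. ?R (7 + (3 + (t1 + (1 + cost (Bin Less (Var ''c'') (Bin Mul (Const 2) (Var ''l''))) + t)))))"
        proof (rule wp_AssignI, simp, (use Bs in simp), rule refl, rule refl, intro conjI)
          have "cost (Bin Less (Var ''c'') (Bin Mul (Const 2) (Var ''l''))) = 7" "cost (Const 0) = 1" "cost (Const 1) = 1"
            by simp_all
          then show "7 + (3 + (t1 + (1 + cost (Bin Less (Var ''c'') (Bin Mul (Const 2) (Var ''l''))) +
              (1 + cost (Const 0) + cost (Const 1))))) \<le> 300000 * l ^ (19 * l) * max 1 n"
            using t1 by (intro bound) linarith
          show "store s ''out'' (val s (Const 0)) (val s (Const 1)) ''out'' 0 =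
            (if strong_triadic_closure E k then 1 else 0)"
            using yes by (simp add: store_app)
        qed
      qed
    qed
    moreover have "1 + cost (Var ''l'') = 3" by simp
    ultimately show ?thesis
      by (intro init wp_IfI) (use False s0 Bs in \<open>simp_all add: s0(2)\<close>)
  qed
qed

text \<open>At \<open>l = 0\<close> the factor \<open>l ^ f l\<close> is \<open>0 ^ 0 = 1\<close>,
  and \<open>max 1 n\<close> accounts for the start-up time on the empty graph. Program, constants
  and the exponent of the word bound are fixed before the instance, so words have logarithmically
  many bits in \<open>n + k + 2\<close>.\<close>

theorem theorem5:
  "\<exists>(P :: com) (f :: nat \<Rightarrow> nat) (c :: nat) (d :: nat).
     (\<lambda>l. real (f l)) \<in> O(\<lambda>l. real l) \<and>
     (\<forall>(n :: nat) (E :: nat set set) (es :: (nat \<times> nat) list) (k :: nat).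
        ugraph {..<n} E \<longrightarrow> edge_list E es \<longrightarrow>
        (\<exists>t. solves_stc P ((n + k + 2) ^ d) n E es k t \<and>
             (let l = card E - k in t \<le> c * l ^ f l * max 1 n)))"
proof (rule exI[of _ main_com], rule exI[of _ "\<lambda>l. 19 * l"], rule exI[of _ 300000],
    rule exI[of _ 10], intro conjI allI impI)
  show "(\<lambda>l. real (19 * l)) \<in> O(\<lambda>l. real l)" by simp
  fix n :: nat and E :: "nat set set" and es :: "(nat \<times> nat) list" and k :: nat
  assume "ugraph {..<n} E" "edge_list E es"
  from wp_main[OF this refl, of k]
  show "\<exists>t. solves_stc main_com ((n + k + 2) ^ 10) n E es k t \<and>
      (let l = card E - k in t \<le> 300000 * l ^ (19 * l) * max 1 n)"
    unfolding wp_def solves_stc_def Let_def by blast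
qed

end
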